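(* Let $K$ be a complete, algebraically closed nonarchimedean valued field and let $\varphi(z)\in K(z)$ have degree $d\ge 1$. Then $$\mathrm{Lip}_{\mathbf P^1(K)}(\varphi)\le \frac{1}{|\mathrm{Res}(\varphi)|},\qquad \mathrm{Lip}_{\mathrm{Berk}}(\varphi)\le \max\Big(\frac{d}{|\mathrm{Res}(\varphi)|},\ \frac{1}{|\mathrm{Res}(\varphi)|^{d}}\Big).$$
   Context: $K$ is a complete, algebraically closed field with a nontrivial nonarchimedean absolute value $|\cdot|$; $\mathcal O=\{z\in K:|z|\le 1\}$ is its valuation ring, $\mathcal O^\times$ its unit group. Fix $q>1$ and write $\log=\log_q$. $\mathbf P^1_{\mathrm{Berk}}$ is the Berkovich projective line over $K$: a uniquely path-connected space (a tree) containing $\mathbf P^1(K)=K\cup\{\infty\}$; for $a\in K$, $r>0$, $\zeta_{a,r}$ is the point corresponding to the disc $D(a,r)=\{z\in K:|z-a|\le r\}$ (so $\zeta_{a,r}=\zeta_{b,r}$ iff $|a-b|\le r$), and $\zeta_{a,0}=a$; $\zeta_G=\zeta_{0,1}$ is the Gauss point; $[x,y]$ denotes the unique path from $x$ to $y$. On $\mathbf H^1=\mathbf P^1_{\mathrm{Berk}}\setminus\mathbf P^1(K)$ the logarithmic path metric $\rho$ gives the path $\{\zeta_{a,r}:R_1\le r\le R_2\}$ length $\log(R_2/R_1)$. Define $\mathrm{diam}_G(x)=q^{-\rho(\zeta_G,x)}$ for $x\in\mathbf H^1$ and $\mathrm{diam}_G(x)=0$ for $x\in\mathbf P^1(K)$;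 explicitly $\mathrm{diam}_G(\zeta_{a,r})=r/\max(1,|a|,r)^2$. Let $x\vee_G y$ be the first point where the paths $[x,\zeta_G]$ and $[y,\zeta_G]$ meet, and define the Favre–Rivera-Letelier metric $d(x,y)=2\,\mathrm{diam}_G(x\vee_G y)-\mathrm{diam}_G(x)-\mathrm{diam}_G(y)$. The spherical metric on $\mathbf P^1(K)$ is $\|x,y\|=|x-y|/(\max(1,|x|)\max(1,|y|))$ for $x,y\in K$ and $\|x,\infty\|=1/\max(1,|x|)$. A nonconstant $\varphi\in K(z)$ acts continuously on $\mathbf P^1_{\mathrm{Berk}}$, extending its action on $\mathbf P^1(K)$. Define $\mathrm{Lip}_{\mathrm{Berk}}(\varphi)=\sup_{x\ne y\in\mathbf P^1_{\mathrm{Berk}}} d(\varphi(x),\varphi(y))/d(x,y)$ and $\mathrm{Lip}_{\mathbf P^1(K)}(\varphi)=\sup_{x\ne y\in\mathbf P^1(K)}\|\varphi(x),\varphi(y)\|/\|x,y\|$. A normalized representation of $\varphi$ is a pair of homogeneous $F,G\in\mathcal O[X,Y]$ of degree $d$, with no common factor, at least one coefficient in $\mathcal O^\times$, such that $\varphi([X:Y])=[F(X,Y):G(X,Y)]$ (with $z=X/Y$); $|\mathrm{Res}(\varphi)|:=|\mathrm{Res}(F,G)|$ (the usual Sylvester resultant of the coefficient sequences), which is independent of the choice of normalized representation. *)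

theory Defs
  imports "HOL-Computational_Algebra.Polynomial" "HOL-Library.Extended_Real"
          "Subresultants.Resultant_Prelim"
begin

definition nonarch_abs :: "('k::field \<Rightarrow> real) \<Rightarrow> bool" where
  "nonarch_abs av \<longleftrightarrow> (\<forall>x. av x \<ge> 0) \<and> (\<forall>x. av x = 0 \<longleftrightarrow> x = 0)
     \<and> (\<forall>x y. av (x * y) = av x * av y) \<and> (\<forall>x y. av (x + y) \<le> max (av x) (av y))"

definition nontrivial_abs :: "('k::field \<Rightarrow> real) \<Rightarrow> bool" where
  "nontrivial_abs av \<longleftrightarrow> (\<exists>x. av x \<noteq> 0 \<and> av x \<noteq> 1)"

definition complete_abs :: "('k::field \<Rightarrow> real) \<Rightarrow> bool" where
  "complete_abs av \<longleftrightarrow> (\<forall>X :: nat \<Rightarrow> 'k.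
     (\<forall>e>0. \<exists>N. \<forall>m\<ge>N. \<forall>n\<ge>N. av (X m - X n) < e) \<longrightarrow>
     (\<exists>L. \<forall>e>0. \<exists>N. \<forall>n\<ge>N. av (X n - L) < e))"

definition alg_closed :: "'k::field itself \<Rightarrow> bool" where
  "alg_closed _ \<longleftrightarrow> (\<forall>p :: 'k poly. degree p \<ge> 1 \<longrightarrow> (\<exists>z. poly p z = 0))"

text \<open>A point of the Berkovich affine line is a multiplicative seminorm on K[T]
  extending the absolute value of K; the projective line adds the point infinity.\<close>

datatype 's berk_pt = BAff 's | BInf
type_synonym 'k berk = "('k poly \<Rightarrow> real) berk_pt"

definition berk_seminorm :: "('k::field \<Rightarrow> real) \<Rightarrow> ('k poly \<Rightarrow> real) \<Rightarrow> bool" where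
  "berk_seminorm av s \<longleftrightarrow> (\<forall>c. s [:c:] = av c) \<and> (\<forall>p q. s (p * q) = s p * s q)
     \<and> (\<forall>p q. s (p + q) \<le> s p + s q) \<and> (\<forall>p. s p \<ge> 0)"

definition P1Berk :: "('k::field \<Rightarrow> real) \<Rightarrow> 'k berk set" where
  "P1Berk av = insert BInf {BAff s | s. berk_seminorm av s}"

definition type1 :: "('k::field \<Rightarrow> real) \<Rightarrow> 'k \<Rightarrow> 'k berk" where
  "type1 av a = BAff (\<lambda>p. av (poly p a))"

definition P1K_in :: "('k::field \<Rightarrow> real) \<Rightarrow> 'k berk set" where
  "P1K_in av = insert BInf (range (type1 av))"

definition gauss :: "('k::field \<Rightarrow> real) \<Rightarrow> 'k berk" where
  "gauss av = BAff (\<lambda>p. Max {av (coeff p i) | i. i \<le> degree p})"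

text \<open>Tree order on the affine Berkovich line rooted at infinity.\<close>
definition berk_le :: "('k poly \<Rightarrow> real) \<Rightarrow> ('k poly \<Rightarrow> real) \<Rightarrow> bool" where
  "berk_le s t \<longleftrightarrow> (\<forall>p. s p \<le> t p)"

fun seg :: "('k::field \<Rightarrow> real) \<Rightarrow> 'k berk \<Rightarrow> 'k berk \<Rightarrow> 'k berk set" where
  "seg av (BAff s) (BAff t) = {BAff u | u. berk_seminorm av u \<and> (berk_le s u \<or> berk_le t u) \<and>
      (\<forall>w. berk_seminorm av w \<and> berk_le s w \<and> berk_le t w \<longrightarrow> berk_le u w)}"
| "seg av (BAff s) BInf = insert BInf {BAff u | u. berk_seminorm av u \<and> berk_le s u}"
| "seg av BInf (BAff t) = insert BInf {BAff u | u. berk_seminorm av u \<and> berk_le t u}"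
| "seg av BInf BInf = {BInf}"

definition join_G :: "('k::field \<Rightarrow> real) \<Rightarrow> 'k berk \<Rightarrow> 'k berk \<Rightarrow> 'k berk" where
  "join_G av x y = (THE z. z \<in> seg av x (gauss av) \<and> seg av x z \<inter> seg av y (gauss av) = {z})"

text \<open>diam_G: 0 on P^1(K); on H^1 given by diam(x)/max(1,[T]_x)^2, which is
  r / max(1,|a|,r)^2 at zeta_{a,r} (and its limit at type IV points).\<close>
definition diam_G :: "('k::field \<Rightarrow> real) \<Rightarrow> 'k berk \<Rightarrow> real" where
  "diam_G av x = (if x \<in> P1K_in av then 0 else
     (case x of BAff s \<Rightarrow> (INF a. s [:-a, 1:]) / (max 1 (s [:0, 1:]))\<^sup>2 | BInf \<Rightarrow> 0))"

definition frl_dist :: "('k::field \<Rightarrow> real) \<Rightarrow> 'k berk \<Rightarrow> 'k berk \<Rightarrow> real" where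
  "frl_dist av x y = 2 * diam_G av (join_G av x y) - diam_G av x - diam_G av y"

text \<open>A homogeneous form F(X,Y) = sum_{i\<le>d} a_i X^i Y^(d-i) is encoded by the
  polynomial f(z) = F(z,1) together with d.  The pair (F,G) is a normalized
  representation of degree d.\<close>
definition normalized_rep :: "('k::field \<Rightarrow> real) \<Rightarrow> nat \<Rightarrow> 'k poly \<Rightarrow> 'k poly \<Rightarrow> bool" where
  "normalized_rep av d f g \<longleftrightarrow> degree f \<le> d \<and> degree g \<le> d \<and> (degree f = d \<or> degree g = d)
     \<and> coprime f g \<and> (\<forall>i. av (coeff f i) \<le> 1 \<and> av (coeff g i) \<le> 1)
     \<and> (\<exists>i. av (coeff f i) = 1 \<or> av (coeff g i) = 1)"

text \<open>Res(F,G): Sylvester resultant of the coefficient sequences (a_0..a_d),(b_0..b_d).\<close>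
definition Res_hom :: "nat \<Rightarrow> 'k::field poly \<Rightarrow> 'k poly \<Rightarrow> 'k" where
  "Res_hom d f g = resultant_sub d d f g"

text \<open>Action on P^1(K), with None = infinity.\<close>
definition phi_P1 :: "nat \<Rightarrow> 'k::field poly \<Rightarrow> 'k poly \<Rightarrow> 'k option \<Rightarrow> 'k option" where
  "phi_P1 d f g x = (case x of
      None \<Rightarrow> (if coeff g d = 0 then None else Some (coeff f d / coeff g d))
    | Some a \<Rightarrow> (if poly g a = 0 then None else Some (poly f a / poly g a)))"

definition chordal :: "('k::field \<Rightarrow> real) \<Rightarrow> 'k option \<Rightarrow> 'k option \<Rightarrow> real" where
  "chordal av x y = (case (x, y) of
      (Some a, Some b) \<Rightarrow> av (a - b) / (max 1 (av a) * max 1 (av b))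
    | (Some a, None) \<Rightarrow> 1 / max 1 (av a)
    | (None, Some b) \<Rightarrow> 1 / max 1 (av b)
    | (None, None) \<Rightarrow> 0)"

text \<open>g^(deg h) * h(f/g), a polynomial.\<close>
definition hcomp :: "'k::field poly \<Rightarrow> 'k poly \<Rightarrow> 'k poly \<Rightarrow> 'k poly" where
  "hcomp f g h = (\<Sum>i\<le>degree h. smult (coeff h i) (f ^ i * g ^ (degree h - i)))"

text \<open>Action on the Berkovich line: [h]_{phi(x)} = [h(phi)]_x.\<close>
definition phi_berk :: "('k::field \<Rightarrow> real) \<Rightarrow> nat \<Rightarrow> 'k poly \<Rightarrow> 'k poly \<Rightarrow> 'k berk \<Rightarrow> 'k berk" where
  "phi_berk av d f g x = (case x of
      BInf \<Rightarrow> (if coeff g d = 0 then BInf else type1 av (coeff f d / coeff g d))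
    | BAff s \<Rightarrow> (if s g = 0 then BInf else BAff (\<lambda>h. s (hcomp f g h) / (s g) ^ degree h)))"

definition Lip_P1 :: "('k::field \<Rightarrow> real) \<Rightarrow> nat \<Rightarrow> 'k poly \<Rightarrow> 'k poly \<Rightarrow> ereal" where
  "Lip_P1 av d f g = (SUP xy \<in> {(x, y). x \<noteq> y}.
      ereal (chordal av (phi_P1 d f g (fst xy)) (phi_P1 d f g (snd xy)) / chordal av (fst xy) (snd xy)))"

definition Lip_Berk :: "('k::field \<Rightarrow> real) \<Rightarrow> nat \<Rightarrow> 'k poly \<Rightarrow> 'k poly \<Rightarrow> ereal" where
  "Lip_Berk av d f g = (SUP xy \<in> {(x, y). x \<in> P1Berk av \<and> y \<in> P1Berk av \<and> x \<noteq> y}.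
      ereal (frl_dist av (phi_berk av d f g (fst xy)) (phi_berk av d f g (snd xy))
             / frl_dist av (fst xy) (snd xy)))"

end

theory Submission
  imports Defs
begin

text \<open>
  A point $x$ of the Berkovich line is recorded by the function $N_x$ giving, for each $P$ in
  $\mathbf P^1(K)$, the normalised value at $x$ of the linear form vanishing at $P$ (the spherical
  distance when $x$ is of type I).  Then $\mathrm{diam}_G(x) = \inf_P N_x(P)$ and
  $\mathrm{diam}_G(x \vee_G y) = \inf_P \max(N_x(P), N_y(P))$.

  Since $F(P) G - G(P) F$ vanishes at $P$ and the adjugate of the Sylvester matrix gives
  $\max(|F|_x, |G|_x) \ge |\mathrm{Res}|$, one has $N_{\varphi(x)}(\varphi(P)) \le N_x(P) / |\mathrm{Res}|$.
  For $x$ in $\mathbf P^1(K)$ this is the first bound; in general it shows that $\varphi$ expands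
  $\mathrm{diam}_G$ of a join by at most $1/|\mathrm{Res}|$.  As the forms $F - bG$ have degree $d$,
  $\varphi$ stretches the hyperbolic path metric by at most $d$; on a short radial segment the two facts
  together bound the stretching of the metric by $d/|\mathrm{Res}|$ up to a factor tending to one, and
  subdividing the paths towards the Gauss point gives $\mathrm{Lip}_{\mathrm{Berk}}(\varphi) \le d/|\mathrm{Res}|$.
\<close>

subsection \<open>Nonarchimedean absolute values and multiplicative seminorms\<close>

text \<open>Infima over linear forms avoid a classification of points: a type IV point has no centre
  and its infimum is not attained, but near-minimisers suffice throughout. They also restore a
  symmetry that affine coordinates break: segments are defined by the order rooted at infinity,
  joins and diameters by the Gauss point, so the two orders have to be translated into each other.
  The hyperbolic estimate is multiplicative. If diameters grow by a factor \<lambda> along a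
  segment, the image has J^2 <= \<lambda>^d \<delta> \<epsilon>, with J the diameter of the join and
  \<delta>, \<epsilon> those of the image endpoints. By AM-GM, 2J - \<delta> - \<epsilon> <= 2J (1 -
  \<lambda>^(-d/2)), roughly J d log \<lambda> for \<lambda> near 1. Since J <= diam/|Res| and diam
  log \<lambda> is roughly the length of the segment, the constant d/|Res| appears, but only
  locally; hence the subdivision. The image of a segment may fold, so the pieces are added by the
  triangle inequality. Endpoints of diameter zero are at infinite hyperbolic distance and need a
  limit.\<close>

lemma max_1_pos [simp]: "0 < max 1 (x::real)" "max 1 x \<noteq> 0" by auto

lemma max_le_mult_max:
  fixes S a :: real
  assumes "S \<ge> 0" and "a \<ge> 0"
  shows "max S a \<le> max 1 S * max 1 a"
proof -
  have "S * 1 \<le> max 1 S * max 1 a" "1 * a \<le> max 1 S * max 1 a"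
    using assms by (intro mult_mono; simp)+
  then show ?thesis by simp
qed

lemma divide_le_max:
  fixes c :: real
  assumes "x \<le> max y z" and "c > 0"
  shows "x / c \<le> max (y / c) (z / c)"
  using assms by (auto simp: le_max_iff_disj divide_right_mono)

text \<open>The function t -> max(t, c)/t is nonincreasing for t > 0.\<close>

lemma mult_max_le:
  fixes U :: real
  assumes "1 \<le> U" "U \<le> S" "c \<ge> 0"
  shows "U * max S c \<le> S * max U c"
proof -
  have "U * c \<le> S * c" using assms by (intro mult_right_mono) auto
  then show ?thesis using assms by (auto simp: max_mult_distrib_left mult.commute[of U S])
qed

lemma max_1_divide: "G > 0 \<Longrightarrow> max 1 (F / G) = max F G / (G::real)"
  by (auto simp: max_def field_simps)

text \<open>Bernoulli's inequality alone grows only linearly in n. Applied to the square root of x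
  and then squared, it gives quadratic growth, which beats n + 1 as soon as n y^2 > 1.\<close>

lemma power_le_linear_imp_le_1:
  fixes x :: real
  assumes "x \<ge> 0" and "\<And>n. x ^ n \<le> real (n + 1)"
  shows "x \<le> 1"
proof (rule ccontr)
  assume "\<not> x \<le> 1"
  then have x: "x > 1" by simp
  define y where "y = sqrt x - 1"
  have y: "y > 0" using x by (simp add: y_def)
  have xy: "x = (1 + y)\<^sup>2" using x by (simp add: y_def)
  obtain n :: nat where n: "real n > 1 / y\<^sup>2" using reals_Archimedean2 by blast
  then have n': "real n * y\<^sup>2 > 1" using y by (simp add: field_simps)
  have n0: "real n > 0" using n y by (smt (verit) zero_less_divide_1_iff zero_less_power)
  have "1 + real n * y \<le> (1 + y) ^ n" using y Bernoulli_inequality[of y n] by simp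
  then have "(1 + real n * y)\<^sup>2 \<le> ((1 + y) ^ n)\<^sup>2"
    by (intro power_mono) (use y in auto)
  also have "\<dots> = x ^ n" unfolding xy by (simp add: power_mult[symmetric] mult.commute)
  also have "\<dots> \<le> real n + 1" using assms(2)[of n] by simp
  finally have "1 + 2 * real n * y + real n * (real n * y\<^sup>2) \<le> real n + 1"
    by (simp add: power2_eq_square algebra_simps)
  moreover have "real n * (real n * y\<^sup>2) > real n * 1"
    using n0 n' by (intro mult_strict_left_mono) auto
  moreover have "real n * y > 0" using n0 y by simp
  ultimately show False by linarith
qed

locale nonarch_closed =
  fixes av :: "'k::field \<Rightarrow> real"
  assumes nonarch: "nonarch_abs av" and closed: "alg_closed TYPE('k)"
begin

lemma av_nonneg [simp]: "av x \<ge> 0" using nonarch unfolding nonarch_abs_def by blast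
lemma av_eq_0 [simp]: "av x = 0 \<longleftrightarrow> x = 0" using nonarch unfolding nonarch_abs_def by blast
lemma av_0 [simp]: "av 0 = 0" by simp
lemma av_mult [simp]: "av (x * y) = av x * av y" using nonarch unfolding nonarch_abs_def by blast
lemma av_add: "av (x + y) \<le> max (av x) (av y)" using nonarch unfolding nonarch_abs_def by blast

lemma av_pos [simp]: "av x > 0 \<longleftrightarrow> x \<noteq> 0"
  using av_nonneg[of x] av_eq_0[of x] by linarith

lemma av_1 [simp]: "av 1 = 1"
  using av_mult[of 1 1] av_eq_0[of 1] by (simp del: av_mult)

lemma av_minus [simp]: "av (- x) = av x"
proof -
  have "av (-1) * av (-1) = 1" using av_mult[of "-1" "-1"] by (simp del: av_mult)
  then have "av (-1) = 1"
    using av_nonneg[of "-1"] by (metis abs_of_nonneg real_sqrt_abs2 real_sqrt_one)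
  then show ?thesis using av_mult[of "-1" x] by simp
qed

lemma av_diff: "av (x - y) \<le> max (av x) (av y)"
  using av_add[of x "-y"] by simp

lemma av_minus_commute: "av (x - y) = av (y - x)"
  by (metis av_minus minus_diff_eq)

lemma av_power [simp]: "av (x ^ n) = av x ^ n"
  by (induction n) auto

lemma av_divide [simp]: "av (x / y) = av x / av y"
  by (cases "y = 0") (auto simp: field_simps simp flip: av_mult)

lemma av_of_nat_le_1: "av (of_nat n) \<le> 1"
proof (induction n)
  case (Suc n)
  then show ?case using av_add[of 1 "of_nat n"] by simp
qed simp

lemma av_sum_le:
  assumes "\<And>i. i \<in> A \<Longrightarrow> av (h i) \<le> M" and "M \<ge> 0"
  shows "av (sum h A) \<le> M"
  using assms
proof (induction A rule: infinite_finite_induct)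
  case (insert x F)
  then have "av (sum h F) \<le> M" "av (h x) \<le> M" by auto
  then show ?case using av_add[of "h x" "sum h F"] insert.hyps by simp
qed auto

lemma av_prod: "av (prod h A) = (\<Prod>i\<in>A. av (h i))"
  by (induction A rule: infinite_finite_induct) auto

text \<open>Every nonzero polynomial is a constant times linear factors. The rule lets
  multiplicative quantities be compared on constants and linear polynomials alone.\<close>

lemma closed_poly_induct [case_names zero const linear]:
  fixes p :: "'k poly"
  assumes "P 0" and "\<And>c. c \<noteq> 0 \<Longrightarrow> P [:c:]"
    and "\<And>a q. q \<noteq> 0 \<Longrightarrow> P q \<Longrightarrow> P ([:-a, 1:] * q)"
  shows "P p"
proof (induction "degree p" arbitrary: p)
  case 0
  then show ?case using assms by (metis degree_eq_zeroE pCons_0_0)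
next
  case (Suc n)
  then obtain a where "poly p a = 0"
    using closed unfolding alg_closed_def by (metis One_nat_def Suc_le_mono le0)
  then obtain q where q: "p = [:-a, 1:] * q" by (metis poly_eq_0_iff_dvd dvdE)
  then have "q \<noteq> 0" using Suc by auto
  then have "degree p = Suc (degree q)" unfolding q by (subst degree_mult_eq) auto
  then show ?case using Suc q assms(3) \<open>q \<noteq> 0\<close> by simp
qed

end

locale berk_point = nonarch_closed av for av :: "'k::field \<Rightarrow> real" +
  fixes s :: "'k poly \<Rightarrow> real"
  assumes seminorm: "berk_seminorm av s"
begin

lemma const [simp]: "s [:c:] = av c" using seminorm unfolding berk_seminorm_def by blast
lemma mult: "s (p * q) = s p * s q" using seminorm unfolding berk_seminorm_def by blast
lemma add_le: "s (p + q) \<le> s p + s q" using seminorm unfolding berk_seminorm_def by blast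
lemma nonneg [simp]: "s p \<ge> 0" using seminorm unfolding berk_seminorm_def by blast
lemma zero [simp]: "s 0 = 0" using const[of 0] by simp
lemma one [simp]: "s 1 = 1" using const[of 1] by (simp add: pCons_one)
lemma power: "s (p ^ n) = s p ^ n" by (induction n) (auto simp: mult)
lemma smult [simp]: "s (smult c p) = av c * s p"
  using mult[of "[:c:]" p] by simp
lemma minus [simp]: "s (- p) = s p" using smult[of "-1" p] by simp
lemma of_nat_le_1: "s (of_nat n) \<le> 1"
  by (simp add: of_nat_poly av_of_nat_le_1)

lemma sum_le: "s (sum h A) \<le> (\<Sum>i\<in>A. s (h i))"
proof (induction A rule: infinite_finite_induct)
  case (insert x F)
  then show ?case using add_le[of "h x" "sum h F"] by simp
qed auto

text \<open>Comparing $(p+q)^n$ with its binomial expansion upgrades the triangle inequality to the strong one.\<close>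

lemma add: "s (p + q) \<le> max (s p) (s q)"
proof (cases "max (s p) (s q) = 0")
  case True
  then show ?thesis using add_le[of p q] nonneg[of p] nonneg[of q] by linarith
next
  case False
  define M where "M = max (s p) (s q)"
  have M: "M > 0" using False nonneg[of p] by (simp add: M_def less_max_iff_disj)
    (metis less_eq_real_def max_def nonneg)
  have "(s (p + q) / M) ^ n \<le> real (n + 1)" for n
  proof -
    have "s (p + q) ^ n = s ((p + q) ^ n)" by (simp add: power)
    also have "\<dots> \<le> (\<Sum>k\<le>n. s (of_nat (n choose k) * p ^ k * q ^ (n - k)))"
      unfolding binomial_ring by (rule sum_le)
    also have "\<dots> \<le> (\<Sum>k\<le>n. M ^ n)"
    proof (rule sum_mono)
      fix k assume k: "k \<in> {..n}"
      have "s (of_nat (n choose k) * p ^ k * q ^ (n - k)) = s (of_nat (n choose k)) * (s p ^ k * s q ^ (n - k))"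
        by (simp add: mult power)
      also have "\<dots> \<le> 1 * (M ^ k * M ^ (n - k))"
        by (intro mult_mono of_nat_le_1 power_mono) (use M in \<open>auto simp: M_def\<close>)
      also have "\<dots> = M ^ n" using k by (simp flip: power_add)
      finally show "s (of_nat (n choose k) * p ^ k * q ^ (n - k)) \<le> M ^ n" .
    qed
    also have "\<dots> = real (n + 1) * M ^ n" by simp
    finally show ?thesis using M by (simp add: power_divide field_simps)
  qed
  then have "s (p + q) / M \<le> 1"
    by (intro power_le_linear_imp_le_1) (use M in auto)
  then show ?thesis using M by (simp add: M_def)
qed

lemma diff: "s (p - q) \<le> max (s p) (s q)"
  using add[of p "-q"] by simp

lemma sum_le_max:
  assumes "\<And>i. i \<in> A \<Longrightarrow> s (h i) \<le> M" and "M \<ge> 0"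
  shows "s (sum h A) \<le> M"
  using assms
proof (induction A rule: infinite_finite_induct)
  case (insert x F)
  then have "s (sum h F) \<le> M" "s (h x) \<le> M" by auto
  then show ?case using add[of "h x" "sum h F"] insert.hyps by simp
qed auto

lemma linear_le: "s [:-a, 1:] \<le> max (s [:-b, 1:]) (av (a - b))"
proof -
  have "[:-a, 1:] = [:-b, 1:] - [:a - b:]" by simp
  then show ?thesis using diff[of "[:-b, 1:]" "[:a - b:]"] by simp
qed

lemma av_diff_le_linear: "av (a - b) \<le> max (s [:-a, 1:]) (s [:-b, 1:])"
proof -
  have "[:a - b:] = [:-b, 1:] - [:-a, 1:]" by simp
  then show ?thesis using diff[of "[:-b, 1:]" "[:-a, 1:]"] const[of "a - b"] by (simp add: max.commute)
qed

lemma linear_le_X: "s [:-a, 1:] \<le> max (s [:0, 1:]) (av a)"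
  using linear_le[of a 0] by simp

lemma X_le_linear: "s [:0, 1:] \<le> max (s [:-a, 1:]) (av a)"
  using linear_le[of 0 a] by simp

lemma av_le_linear: "av a \<le> max (s [:-a, 1:]) (s [:0, 1:])"
  using av_diff_le_linear[of a 0] by simp

end

context nonarch_closed begin

lemma berk_pointI: "berk_seminorm av s \<Longrightarrow> berk_point av s"
  by unfold_locales

text \<open>Both seminorms are multiplicative and agree on constants, and every polynomial splits,
  so an inequality on linear factors multiplies up.\<close>

lemma berk_le_iff_linear:
  assumes "berk_seminorm av s" and "berk_seminorm av t"
  shows "berk_le s t \<longleftrightarrow> (\<forall>a. s [:-a, 1:] \<le> t [:-a, 1:])"
proof
  interpret s: berk_point av s by (rule berk_pointI) fact
  interpret t: berk_point av t by (rule berk_pointI) fact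
  assume *: "\<forall>a. s [:-a, 1:] \<le> t [:-a, 1:]"
  have "s p \<le> t p" for p
  proof (induction p rule: closed_poly_induct)
    case (linear a q)
    then show ?case using * unfolding s.mult t.mult by (intro mult_mono) auto
  qed auto
  then show "berk_le s t" by (simp add: berk_le_def)
qed (simp add: berk_le_def)

lemma seminorm_eqI:
  assumes "berk_seminorm av s" and "berk_seminorm av t"
    and "\<And>a. s [:-a, 1:] = t [:-a, 1:]"
  shows "s = t"
  using berk_le_iff_linear[OF assms(1,2)] berk_le_iff_linear[OF assms(2,1)] assms(3)
  by (auto simp: berk_le_def fun_eq_iff intro: antisym)

end

subsection \<open>Gauss norms and discs\<close>

definition gauss_norm :: "('k::field \<Rightarrow> real) \<Rightarrow> real \<Rightarrow> 'k poly \<Rightarrow> real" where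
  "gauss_norm av r p = Max ((\<lambda>i. av (coeff p i) * r ^ i) ` {..degree p})"

text \<open>For \<open>r\<close> > 0 this is the point zeta_{a,r}: the Gauss norm of radius
  \<open>r\<close> after expansion around \<open>a\<close>.\<close>

definition disc_norm :: "('k::field \<Rightarrow> real) \<Rightarrow> 'k \<Rightarrow> real \<Rightarrow> 'k poly \<Rightarrow> real" where
  "disc_norm av a r p = gauss_norm av r (p \<circ>\<^sub>p [:a, 1:])"

context nonarch_closed begin

lemma av_sum_less:
  assumes "\<And>i. i \<in> A \<Longrightarrow> av (h i) < M" and "M > 0"
  shows "av (sum h A) < M"
  using assms
proof (induction A rule: infinite_finite_induct)
  case (insert x F)
  then have "av (sum h F) < M" "av (h x) < M" by auto
  then show ?case using av_add[of "h x" "sum h F"] insert.hyps by simp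
qed auto

lemma coeff_le_gauss_norm:
  assumes "r > 0"
  shows "av (coeff p i) * r ^ i \<le> gauss_norm av r p"
proof (cases "i \<le> degree p")
  case True
  then show ?thesis unfolding gauss_norm_def by (intro Max_ge) auto
next
  case False
  have "av (coeff p 0) * r ^ 0 \<le> gauss_norm av r p"
    unfolding gauss_norm_def by (intro Max_ge) (auto intro!: image_eqI[of _ _ 0])
  then have "0 \<le> gauss_norm av r p" using order_trans[OF av_nonneg] by force
  with False show ?thesis by (simp add: coeff_eq_0)
qed

lemma gauss_norm_attained: "\<exists>i. gauss_norm av r p = av (coeff p i) * r ^ i"
proof -
  have "gauss_norm av r p \<in> (\<lambda>i. av (coeff p i) * r ^ i) ` {..degree p}"
    unfolding gauss_norm_def by (intro Max_in) auto
  then show ?thesis by auto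
qed

lemma gauss_norm_le_iff:
  "r > 0 \<Longrightarrow> gauss_norm av r p \<le> M \<longleftrightarrow> (\<forall>i. av (coeff p i) * r ^ i \<le> M)"
  by (metis coeff_le_gauss_norm gauss_norm_attained order_trans)

lemma gauss_norm_nonneg: "r > 0 \<Longrightarrow> gauss_norm av r p \<ge> 0"
  using gauss_norm_attained[of r p] by auto

lemma gauss_norm_pos:
  assumes "r > 0" and "p \<noteq> 0"
  shows "gauss_norm av r p > 0"
proof -
  have "0 < av (lead_coeff p) * r ^ degree p" using assms by simp
  then show ?thesis using coeff_le_gauss_norm[OF assms(1), of p "degree p"] by linarith
qed

lemma gauss_norm_mult_le:
  assumes "r > 0"
  shows "gauss_norm av r (p * q) \<le> gauss_norm av r p * gauss_norm av r q"
  unfolding gauss_norm_le_iff[OF assms]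
proof
  fix n
  have "av (coeff (p * q) n) \<le> gauss_norm av r p * gauss_norm av r q / r ^ n"
    unfolding coeff_mult
  proof (rule av_sum_le)
    fix i assume "i \<in> {..n}"
    then have "av (coeff p i * coeff q (n - i)) * r ^ n
      = (av (coeff p i) * r ^ i) * (av (coeff q (n - i)) * r ^ (n - i))"
      by (simp add: mult_ac flip: power_add)
    also have "\<dots> \<le> gauss_norm av r p * gauss_norm av r q"
      using assms by (intro mult_mono coeff_le_gauss_norm gauss_norm_nonneg) auto
    finally show "av (coeff p i * coeff q (n - i)) \<le> gauss_norm av r p * gauss_norm av r q / r ^ n"
      using assms by (simp add: field_simps)
  qed (use assms in \<open>auto intro!: gauss_norm_nonneg divide_nonneg_pos mult_nonneg_nonneg\<close>)
  then show "av (coeff (p * q) n) * r ^ n \<le> gauss_norm av r p * gauss_norm av r q"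
    using assms by (simp add: field_simps)
qed

text \<open>Gauss' lemma: the product of the first maximal terms of the factors strictly
  dominates all other contributions to its coefficient.\<close>

lemma gauss_norm_mult_ge:
  assumes r: "r > 0" and p: "p \<noteq> 0" and q: "q \<noteq> 0"
  shows "gauss_norm av r p * gauss_norm av r q \<le> gauss_norm av r (p * q)"
proof -
  define G where "G = gauss_norm av r p"
  define H where "H = gauss_norm av r q"
  have G: "G > 0" and H: "H > 0" using gauss_norm_pos r p q by (auto simp: G_def H_def)
  define i where "i = (LEAST i. av (coeff p i) * r ^ i = G)"
  define j where "j = (LEAST j. av (coeff q j) * r ^ j = H)"
  have i: "av (coeff p i) * r ^ i = G"
    unfolding i_def by (rule LeastI_ex) (metis G_def gauss_norm_attained)
  have j: "av (coeff q j) * r ^ j = H"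
    unfolding j_def by (rule LeastI_ex) (metis H_def gauss_norm_attained)
  have i': "av (coeff p k) * r ^ k < G" if "k < i" for k
    using not_less_Least[OF that[unfolded i_def]] coeff_le_gauss_norm[OF r, of p k]
    by (simp add: G_def order_less_le)
  have j': "av (coeff q k) * r ^ k < H" if "k < j" for k
    using not_less_Least[OF that[unfolded j_def]] coeff_le_gauss_norm[OF r, of q k]
    by (simp add: H_def order_less_le)
  define n where "n = i + j"
  define t where "t k = coeff p k * coeff q (n - k)" for k
  have tk: "av (t k) * r ^ n = (av (coeff p k) * r ^ k) * (av (coeff q (n - k)) * r ^ (n - k))"
    if "k \<le> n" for k
    using that by (simp add: t_def mult_ac flip: power_add)
  have ti: "av (t i) * r ^ n = G * H"
    using tk[of i] by (simp add: n_def i j)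
  have less: "av (t k) < av (t i)" if k: "k \<in> {..n} - {i}" for k
  proof -
    consider "k < i" | "k > i" "k \<le> n" using k by (cases "k < i") auto
    then have "(av (coeff p k) * r ^ k) * (av (coeff q (n - k)) * r ^ (n - k)) < G * H"
    proof cases
      case 1
      have "(av (coeff p k) * r ^ k) * (av (coeff q (n - k)) * r ^ (n - k)) \<le> (av (coeff p k) * r ^ k) * H"
        using coeff_le_gauss_norm[OF r, of q "n - k"] r by (intro mult_left_mono) (auto simp: H_def)
      also have "\<dots> < G * H" using i'[OF 1] H by (intro mult_strict_right_mono)
      finally show ?thesis .
    next
      case 2
      then have k': "n - k < j" by (simp add: n_def)
      have "(av (coeff p k) * r ^ k) * (av (coeff q (n - k)) * r ^ (n - k)) \<le> G * (av (coeff q (n - k)) * r ^ (n - k))"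
        using coeff_le_gauss_norm[OF r, of p k] r by (intro mult_right_mono) (auto simp: G_def)
      also have "\<dots> < G * H" using j'[OF k'] G by (intro mult_strict_left_mono)
      finally show ?thesis .
    qed
    then have "av (t k) * r ^ n < av (t i) * r ^ n" using tk[of k] k ti by simp
    then show ?thesis using r by simp
  qed
  have "av (t i) > 0" using ti G H r
    by (metis av_nonneg mult_pos_pos order_less_le mult_zero_left)
  then have rest: "av (sum t ({..n} - {i})) < av (t i)"
    by (intro av_sum_less less)
  have "coeff (p * q) n = sum t {..n}" by (simp add: coeff_mult t_def)
  also have "\<dots> = t i + sum t ({..n} - {i})" by (rule sum.remove) (auto simp: n_def)
  finally have "t i = coeff (p * q) n - sum t ({..n} - {i})" by simp
  then have "av (t i) \<le> av (coeff (p * q) n)"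
    using av_diff[of "coeff (p * q) n" "sum t ({..n} - {i})"] rest by simp
  then have "av (t i) * r ^ n \<le> av (coeff (p * q) n) * r ^ n"
    using r by (intro mult_right_mono) auto
  also have "\<dots> \<le> gauss_norm av r (p * q)" by (rule coeff_le_gauss_norm[OF r])
  finally show ?thesis unfolding ti G_def H_def .
qed

lemma gauss_norm_mult:
  assumes "r > 0"
  shows "gauss_norm av r (p * q) = gauss_norm av r p * gauss_norm av r q"
proof (cases "p = 0 \<or> q = 0")
  case True
  then show ?thesis by (auto simp: gauss_norm_def)
next
  case False
  then show ?thesis using assms by (intro antisym gauss_norm_mult_le gauss_norm_mult_ge) auto
qed

lemma gauss_norm_add:
  assumes "r > 0"
  shows "gauss_norm av r (p + q) \<le> gauss_norm av r p + gauss_norm av r q"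
  unfolding gauss_norm_le_iff[OF assms]
proof
  fix i
  have "av (coeff (p + q) i) \<le> av (coeff p i) + av (coeff q i)"
    using av_add[of "coeff p i" "coeff q i"] av_nonneg[of "coeff p i"] av_nonneg[of "coeff q i"]
    unfolding coeff_add by linarith
  then have "av (coeff (p + q) i) * r ^ i \<le> av (coeff p i) * r ^ i + av (coeff q i) * r ^ i"
    using assms by (simp flip: distrib_right)
  then show "av (coeff (p + q) i) * r ^ i \<le> gauss_norm av r p + gauss_norm av r q"
    using coeff_le_gauss_norm[OF assms, of p i] coeff_le_gauss_norm[OF assms, of q i] by linarith
qed

lemma disc_norm_seminorm: "r > 0 \<Longrightarrow> berk_seminorm av (disc_norm av a r)"
  unfolding berk_seminorm_def disc_norm_def
  by (auto simp: pcompose_mult pcompose_add gauss_norm_mult gauss_norm_add gauss_norm_nonneg)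
    (simp add: gauss_norm_def)

lemma disc_norm_linear: "r > 0 \<Longrightarrow> disc_norm av a r [:-c, 1:] = max r (av (a - c))"
  by (simp add: disc_norm_def gauss_norm_def atMost_Suc pcompose_pCons max.commute)

lemma disc_norm_X: "r > 0 \<Longrightarrow> disc_norm av a r [:0, 1:] = max r (av a)"
  using disc_norm_linear[of r a 0] by simp

lemma gauss_eq: "gauss av = BAff (disc_norm av 0 1)"
proof -
  have "{av (coeff p i) |i. i \<le> degree p} = (\<lambda>i. av (coeff p i) * 1 ^ i) ` {..degree p}" for p
    by auto
  then show ?thesis by (simp add: gauss_def disc_norm_def gauss_norm_def fun_eq_iff)
qed

lemma type1_seminorm: "berk_seminorm av (\<lambda>p. av (poly p a))"
  unfolding berk_seminorm_def
proof safe
  fix p q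
  show "av (poly (p + q) a) \<le> av (poly p a) + av (poly q a)"
    using av_add[of "poly p a" "poly q a"] av_nonneg[of "poly p a"] av_nonneg[of "poly q a"]
    unfolding poly_add by linarith
qed auto

end

text \<open>The value at a Berkovich point of the linear form vanishing at a point of the projective line
  (\<open>None\<close> being infinity), in homogeneous coordinates scaled to have norm one.\<close>

fun lin_val :: "('k::field \<Rightarrow> real) \<Rightarrow> 'k berk \<Rightarrow> 'k option \<Rightarrow> real" where
  "lin_val av (BAff s) (Some a) = s [:-a, 1:] / (max 1 (s [:0, 1:]) * max 1 (av a))"
| "lin_val av (BAff s) None = 1 / max 1 (s [:0, 1:])"
| "lin_val av BInf (Some a) = 1 / max 1 (av a)"
| "lin_val av BInf None = 0"

definition berk_of :: "('k::field \<Rightarrow> real) \<Rightarrow> 'k option \<Rightarrow> 'k berk" where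
  "berk_of av P = (case P of None \<Rightarrow> BInf | Some a \<Rightarrow> type1 av a)"

context nonarch_closed begin

lemma P1Berk_cases [consumes 1, case_names Inf Aff]:
  assumes "x \<in> P1Berk av"
  obtains "x = BInf" | s where "x = BAff s" and "berk_point av s"
  using assms unfolding P1Berk_def by (auto intro: berk_pointI)

lemma BAff_P1Berk: "BAff s \<in> P1Berk av \<longleftrightarrow> berk_seminorm av s"
  by (auto simp: P1Berk_def)

lemma BInf_P1Berk: "BInf \<in> P1Berk av" by (simp add: P1Berk_def)

lemma berk_of_P1Berk: "berk_of av P \<in> P1Berk av"
  by (auto simp: berk_of_def type1_def BAff_P1Berk BInf_P1Berk type1_seminorm split: option.split)

lemma chordal_eq: "chordal av P Q = lin_val av (berk_of av P) Q"
  by (cases P; cases Q) (auto simp: chordal_def berk_of_def type1_def)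

lemma lin_val_nonneg:
  assumes "x \<in> P1Berk av"
  shows "lin_val av x P \<ge> 0"
  using assms
proof (cases rule: P1Berk_cases)
  case Inf
  then show ?thesis by (cases P) auto
next
  case (Aff s)
  interpret berk_point av s by fact
  show ?thesis using Aff by (cases P) auto
qed

lemma chordal_commute: "chordal av P Q = chordal av Q P"
  by (cases P; cases Q) (auto simp: chordal_def av_minus_commute mult.commute)

lemma chordal_refl [simp]: "chordal av P P = 0"
  by (cases P) (auto simp: chordal_def)

lemma chordal_pos: "P \<noteq> Q \<Longrightarrow> chordal av P Q > 0"
  by (cases P; cases Q) (auto simp: chordal_def)

lemma lin_val_le_1:
  assumes "x \<in> P1Berk av"
  shows "lin_val av x P \<le> 1"
  using assms
proof (cases rule: P1Berk_cases)
  case Inf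
  then show ?thesis by (cases P) auto
next
  case (Aff s)
  interpret berk_point av s by fact
  show ?thesis
  proof (cases P)
    case (Some a)
    have "s [:-a, 1:] \<le> max 1 (s [:0, 1:]) * max 1 (av a)"
      by (rule order_trans[OF linear_le_X max_le_mult_max]) auto
    then show ?thesis using Some Aff by (simp add: field_simps)
  qed (use Aff in auto)
qed

subsection \<open>Values of linear forms\<close>

lemma chordal_simps:
  "chordal av (Some a) (Some b) = av (a - b) / (max 1 (av a) * max 1 (av b))"
  "chordal av (Some a) None = 1 / max 1 (av a)"
  "chordal av None (Some b) = 1 / max 1 (av b)"
  "chordal av None None = 0"
  by (auto simp: chordal_def)

text \<open>The two inequalities below express the Pluecker relations between three homogeneous vectors.\<close>

lemma lin_val_le:
  assumes "x \<in> P1Berk av"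
  shows "lin_val av x P \<le> max (lin_val av x Q) (chordal av P Q)"
  using assms
proof (cases rule: P1Berk_cases)
  case Inf
  show ?thesis
  proof (cases P; cases Q)
    fix a b assume PQ: "P = Some a" "Q = Some b"
    define A where "A = max 1 (av a)"
    define B where "B = max 1 (av b)"
    have AB: "A > 0" "B > 0" by (auto simp: A_def B_def)
    have "av b \<le> max (av a) (av (a - b))" using av_diff[of a "a - b"] by simp
    then have "B \<le> max A (av (a - b))" unfolding A_def B_def by linarith
    from divide_le_max[OF this, of "A * B"] have "1 / A \<le> max (1 / B) (av (a - b) / (A * B))"
      using AB by simp
    then show ?thesis using Inf PQ by (simp add: chordal_simps A_def B_def)
  qed (use Inf in \<open>auto simp: chordal_simps\<close>)
next
  case (Aff s)
  interpret berk_point av s by fact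
  define M where "M = max 1 (s [:0, 1:])"
  have M: "M > 0" by (simp add: M_def)
  show ?thesis
  proof (cases P)
    case None
    show ?thesis
    proof (cases Q)
      case (Some b)
      define B where "B = max 1 (av b)"
      have B: "B > 0" by (simp add: B_def)
      have "B \<le> max (s [:-b, 1:]) M" using av_le_linear[of b] unfolding M_def B_def by linarith
      from divide_le_max[OF this, of "M * B"] have "1 / M \<le> max (s [:-b, 1:] / (M * B)) (1 / B)"
        using M B by simp
      then show ?thesis using Some None Aff by (simp add: chordal_simps M_def B_def)
    qed (use None in auto)
  next
    case (Some a)
    define A where "A = max 1 (av a)"
    have A: "A > 0" by (simp add: A_def)
    show ?thesis
    proof (cases Q)
      case None
      have "s [:-a, 1:] \<le> max A M" using linear_le_X[of a] unfolding M_def A_def by linarith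
      from divide_le_max[OF this, of "M * A"] have "s [:-a, 1:] / (M * A) \<le> max (1 / M) (1 / A)"
        using M A by simp
      then show ?thesis using Some None Aff by (simp add: chordal_simps M_def A_def)
    next
      case Q: (Some b)
      define B where "B = max 1 (av b)"
      have B: "B > 0" by (simp add: B_def)
      \<comment> \<open>The factor \<open>B = max 1 (av b)\<close> equals 1 or \<open>av b\<close>.
        This relation serves the second case, \<open>linear_le\<close> the first.\<close>
      have "smult b [:-a, 1:] = smult a [:-b, 1:] - smult (a - b) [:0, 1:]" by simp
      then have "s (smult b [:-a, 1:]) \<le> max (s (smult a [:-b, 1:])) (s (smult (a - b) [:0, 1:]))"
        by (metis diff)
      then have 1: "av b * s [:-a, 1:] \<le> max (av a * s [:-b, 1:]) (av (a - b) * s [:0, 1:])"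
        by (simp only: smult)
      have 2: "s [:-a, 1:] \<le> max (s [:-b, 1:]) (av (a - b))" by (rule linear_le)
      have le: "av a * s [:-b, 1:] \<le> A * s [:-b, 1:]" "1 * s [:-b, 1:] \<le> A * s [:-b, 1:]"
        "av (a - b) * s [:0, 1:] \<le> av (a - b) * M" "av (a - b) * 1 \<le> av (a - b) * M"
        by (intro mult_left_mono mult_right_mono; simp add: A_def M_def)+
      have "B * s [:-a, 1:] = s [:-a, 1:] \<or> B * s [:-a, 1:] = av b * s [:-a, 1:]"
        by (simp add: B_def max_def)
      then have "B * s [:-a, 1:] \<le> max (A * s [:-b, 1:]) (av (a - b) * M)"
        by (rule disjE) (use 1 2 le in linarith)+
      from divide_le_max[OF this, of "M * A * B"] have "s [:-a, 1:] / (M * A) \<le> max (s [:-b, 1:] / (M * B)) (av (a - b) / (A * B))"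
        using M A B by simp
      then show ?thesis using Some Q Aff by (simp add: chordal_simps M_def A_def B_def)
    qed
  qed
qed

lemma chordal_le:
  assumes "x \<in> P1Berk av"
  shows "chordal av P Q \<le> max (lin_val av x P) (lin_val av x Q)"
  using assms
proof (cases rule: P1Berk_cases)
  case Inf
  show ?thesis
  proof (cases P; cases Q)
    fix a b assume PQ: "P = Some a" "Q = Some b"
    define A where "A = max 1 (av a)"
    define B where "B = max 1 (av b)"
    have AB: "A > 0" "B > 0" by (auto simp: A_def B_def)
    have "av (a - b) \<le> max B A" using av_diff[of a b] unfolding A_def B_def by linarith
    from divide_le_max[OF this, of "A * B"] have "av (a - b) / (A * B) \<le> max (1 / A) (1 / B)"
      using AB by simp
    then show ?thesis using Inf PQ by (simp add: chordal_simps A_def B_def)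
  qed (use Inf in \<open>auto simp: chordal_simps\<close>)
next
  case (Aff s)
  interpret berk_point av s by fact
  define M where "M = max 1 (s [:0, 1:])"
  have M: "M > 0" by (simp add: M_def)
  have inf: "chordal av (Some a) None \<le> max (lin_val av x (Some a)) (lin_val av x None)" for a
  proof -
    define A where "A = max 1 (av a)"
    have A: "A > 0" by (simp add: A_def)
    have "M \<le> max (s [:-a, 1:]) A" using X_le_linear[of a] unfolding M_def A_def by linarith
    from divide_le_max[OF this, of "M * A"] have "1 / A \<le> max (s [:-a, 1:] / (M * A)) (1 / M)"
      using M A by simp
    then show ?thesis using Aff by (simp add: chordal_simps M_def A_def)
  qed
  show ?thesis
  proof (cases P; cases Q)
    fix a b assume PQ: "P = Some a" "Q = Some b"
    define A where "A = max 1 (av a)"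
    define B where "B = max 1 (av b)"
    have A: "A > 0" and B: "B > 0" by (auto simp: A_def B_def)
    have "smult (a - b) [:0, 1:] = smult a [:-b, 1:] - smult b [:-a, 1:]" by simp
    then have "s (smult (a - b) [:0, 1:]) \<le> max (s (smult a [:-b, 1:])) (s (smult b [:-a, 1:]))"
      by (metis diff)
    then have 1: "av (a - b) * s [:0, 1:] \<le> max (av a * s [:-b, 1:]) (av b * s [:-a, 1:])"
      by (simp only: smult)
    have 2: "av (a - b) \<le> max (s [:-a, 1:]) (s [:-b, 1:])" by (rule av_diff_le_linear)
    have le: "av a * s [:-b, 1:] \<le> A * s [:-b, 1:]" "1 * s [:-b, 1:] \<le> A * s [:-b, 1:]"
      "av b * s [:-a, 1:] \<le> B * s [:-a, 1:]" "1 * s [:-a, 1:] \<le> B * s [:-a, 1:]"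
      by (intro mult_right_mono; simp add: A_def B_def)+
    have "av (a - b) * M = av (a - b) \<or> av (a - b) * M = av (a - b) * s [:0, 1:]"
      by (simp add: M_def max_def)
    then have "av (a - b) * M \<le> max (B * s [:-a, 1:]) (A * s [:-b, 1:])"
      by (rule disjE) (use 1 2 le in linarith)+
    from divide_le_max[OF this, of "M * A * B"] have "av (a - b) / (A * B) \<le> max (s [:-a, 1:] / (M * A)) (s [:-b, 1:] / (M * B))"
      using M A B by simp
    then show ?thesis using PQ Aff by (simp add: chordal_simps M_def A_def B_def)
  qed (use inf chordal_commute lin_val_nonneg[OF assms] in \<open>auto simp: max.commute chordal_simps(4) le_max_iff_disj\<close>)
qed

text \<open>The value at infinity recovers the scaling factor max(1,|T|); the other values then give
  the seminorm on all T - a, which determines it.\<close>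

lemma lin_val_inject:
  assumes "x \<in> P1Berk av" and "y \<in> P1Berk av" and eq: "\<And>P. lin_val av x P = lin_val av y P"
  shows "x = y"
  using assms(1)
proof (cases rule: P1Berk_cases)
  case Inf
  then show ?thesis using eq[of None] by (cases y) auto
next
  case s: (Aff s)
  show ?thesis using assms(2)
  proof (cases rule: P1Berk_cases)
    case Inf
    then show ?thesis using eq[of None] s by auto
  next
    case t: (Aff t)
    have "max 1 (s [:0, 1:]) = max 1 (t [:0, 1:])" using eq[of None] s t by simp
    then have "s [:-a, 1:] = t [:-a, 1:]" for a using eq[of "Some a"] s t by simp
    then have "s = t" using s t by (intro seminorm_eqI) (auto simp: berk_point.seminorm)
    then show ?thesis using s t by simp
  qed
qed

section \<open>Diameter, join and distance computed from linear forms\<close>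

definition bdiam :: "'k berk \<Rightarrow> real" where
  "bdiam x = (INF P. lin_val av x P)"

definition bjoin :: "'k berk \<Rightarrow> 'k berk \<Rightarrow> real" where
  "bjoin x y = (INF P. max (lin_val av x P) (lin_val av y P))"

context
  fixes x assumes x: "x \<in> P1Berk av"
begin

lemma bdd_below_lin_val: "bdd_below (range (lin_val av x))"
  by (rule bdd_belowI2[of _ 0]) (simp add: lin_val_nonneg[OF x])

lemma bdiam_le: "bdiam x \<le> lin_val av x P"
  unfolding bdiam_def by (rule cINF_lower[OF bdd_below_lin_val]) simp

lemma bdiam_nonneg: "bdiam x \<ge> 0"
  unfolding bdiam_def by (rule cINF_greatest) (auto simp: lin_val_nonneg[OF x])

lemma bdiam_lessD: "bdiam x < e \<Longrightarrow> \<exists>P. lin_val av x P < e"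
  unfolding bdiam_def by (subst (asm) cINF_less_iff) (auto simp: bdd_below_lin_val)

lemma bdiam_le_1: "bdiam x \<le> 1"
  using bdiam_le[of None] lin_val_le_1[OF x, of None] by linarith

lemma bdd_below_max_lin_val: "bdd_below (range (\<lambda>P. max (lin_val av x P) (lin_val av y P)))"
  by (rule bdd_belowI2[of _ 0]) (simp add: lin_val_nonneg[OF x] le_max_iff_disj)

lemma bjoin_le: "bjoin x y \<le> max (lin_val av x P) (lin_val av y P)"
  unfolding bjoin_def by (rule cINF_lower[OF bdd_below_max_lin_val]) simp

lemma bjoin_lessD: "bjoin x y < e \<Longrightarrow> \<exists>P. lin_val av x P < e \<and> lin_val av y P < e"
  unfolding bjoin_def by (subst (asm) cINF_less_iff) (auto simp: bdd_below_max_lin_val)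

end

lemma bdiam_greatest: "(\<And>P. c \<le> lin_val av x P) \<Longrightarrow> c \<le> bdiam x"
  unfolding bdiam_def by (rule cINF_greatest) auto

lemma bjoin_greatest: "(\<And>P. c \<le> max (lin_val av x P) (lin_val av y P)) \<Longrightarrow> c \<le> bjoin x y"
  unfolding bjoin_def by (rule cINF_greatest) auto

lemma bjoin_commute: "bjoin x y = bjoin y x"
  by (simp add: bjoin_def max.commute)

lemma bdiam_le_bjoin: "x \<in> P1Berk av \<Longrightarrow> bdiam x \<le> bjoin x y"
  by (rule bjoin_greatest) (metis bdiam_le le_max_iff_disj)

lemma bjoin_le_1: "x \<in> P1Berk av \<Longrightarrow> y \<in> P1Berk av \<Longrightarrow> bjoin x y \<le> 1"
  using bjoin_le[of x y None] lin_val_le_1[of x None] lin_val_le_1[of y None] by linarith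

text \<open>A point Q nearly realising the join is close to both \<open>x\<close> and
  \<open>y\<close>; going from P to Q in the chordal metric transfers the value at \<open>y\<close>
  to \<open>x\<close>. By symmetry, cutting off the values of \<open>x\<close> and of
  \<open>y\<close> at \<open>bjoin x y\<close> produces the same function.\<close>

lemma lin_val_le_bjoin:
  assumes x: "x \<in> P1Berk av" and y: "y \<in> P1Berk av"
  shows "lin_val av x P \<le> max (bjoin x y) (lin_val av y P)"
proof (rule dense_ge)
  fix e assume "max (bjoin x y) (lin_val av y P) < e"
  then have e: "bjoin x y < e" "lin_val av y P < e" by auto
  obtain Q where "lin_val av x Q < e" "lin_val av y Q < e" using bjoin_lessD[OF x e(1)] by blast
  then show "lin_val av x P \<le> e"
    using lin_val_le[OF x, of P Q] chordal_le[OF y, of P Q] e by linarith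
qed

lemma bjoin_ultra:
  assumes x: "x \<in> P1Berk av" and y: "y \<in> P1Berk av" and z: "z \<in> P1Berk av"
  shows "bjoin x y \<le> max (bjoin x z) (bjoin z y)"
proof (rule dense_ge)
  fix e assume "max (bjoin x z) (bjoin z y) < e"
  then have e: "bjoin x z < e" "bjoin z y < e" by auto
  obtain Q where Q: "lin_val av x Q < e" "lin_val av z Q < e" using bjoin_lessD[OF x e(1)] by blast
  have "lin_val av y Q < e"
    using lin_val_le_bjoin[OF y z, of Q] Q e by (simp add: bjoin_commute)
  then show "bjoin x y \<le> e" using bjoin_le[OF x, of y Q] Q by linarith
qed

definition bdist :: "'k berk \<Rightarrow> 'k berk \<Rightarrow> real" where
  "bdist x y = 2 * bjoin x y - bdiam x - bdiam y"

text \<open>The join of \<open>x\<close> and \<open>y\<close> is at most the larger of the joins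
  with \<open>z\<close>. The smaller one is at least \<open>bdiam z\<close>, which pays for the two
  subtracted terms \<open>bdiam z\<close>.\<close>

lemma bdist_triangle:
  assumes x: "x \<in> P1Berk av" and y: "y \<in> P1Berk av" and z: "z \<in> P1Berk av"
  shows "bdist x y \<le> bdist x z + bdist z y"
  using bjoin_ultra[OF assms] bdiam_le_bjoin[OF z, of x] bdiam_le_bjoin[OF z, of y]
  by (auto simp: bdist_def bjoin_commute[of z x])

lemma bdist_commute: "bdist x y = bdist y x"
  by (simp add: bdist_def bjoin_commute)

text \<open>The witness is the point of G-diameter \<open>j\<close> on the path from P to the Gauss
  point; its radius solves r / max(1,|a|,r)^2 = j. Infinity gives zeta_{0,1/j}, a centre with |a| <=
  1 gives zeta_{a,j}, and |a| > 1 gives r = j |a|^2 as long as this stays at most |a|.\<close>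

lemma disc_point_exists:
  assumes j: "0 < j" "j \<le> 1"
  shows "\<exists>z\<in>P1Berk av. \<forall>Q. lin_val av z Q = max j (chordal av P Q)"
proof -
  have inf: "\<exists>z\<in>P1Berk av. \<forall>Q. lin_val av z Q = max j (chordal av None Q)"
  proof (rule bexI[of _ "BAff (disc_norm av 0 (1 / j))"], rule allI)
    fix Q show "lin_val av (BAff (disc_norm av 0 (1 / j))) Q = max j (chordal av None Q)"
    proof (cases Q)
      case (Some c)
      have "max (1 / j) (av c) / (1 / j * max 1 (av c)) = max j (1 / max 1 (av c))"
        using j mult_right_mono[of j 1 "av c"] by (auto simp: max_def field_simps)
      then show ?thesis using j Some
        by (simp add: disc_norm_linear disc_norm_X chordal_simps max_absorb2)
    qed (use j in \<open>simp add: disc_norm_X chordal_simps max_absorb2\<close>)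
  qed (use j in \<open>simp add: BAff_P1Berk disc_norm_seminorm\<close>)
  show ?thesis
  proof (cases P)
    case (Some a)
    consider "av a \<le> 1" | "av a > 1" "j * av a \<le> 1" | "av a > 1" "j * av a > 1" by linarith
    then show ?thesis
    proof cases
      case 1
      show ?thesis
      proof (rule bexI[of _ "BAff (disc_norm av a j)"], rule allI)
        fix Q show "lin_val av (BAff (disc_norm av a j)) Q = max j (chordal av P Q)"
        proof (cases Q)
          case Q: (Some c)
          have "max j (av (a - c)) / max 1 (av c) = max j (av (a - c) / max 1 (av c))"
          proof (cases "av c \<le> 1")
            case False
            then have "av (a - c) = av c"
              using 1 av_diff[of a c] av_diff[of a "a - c"] by simp
            moreover have "c \<noteq> 0" using False by auto
            ultimately show ?thesis using False j by (simp add: max_absorb2)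
          qed (simp add: max_absorb1)
          then show ?thesis using j Some Q 1
            by (simp add: disc_norm_linear disc_norm_X chordal_simps)
        qed (use j 1 Some in \<open>simp add: disc_norm_X chordal_simps max_absorb2\<close>)
      qed (use j in \<open>simp add: BAff_P1Berk disc_norm_seminorm\<close>)
    next
      case 2
      define r where "r = j * (av a)\<^sup>2"
      have a: "a \<noteq> 0" using 2 by auto
      then have r: "r > 0" using j by (simp add: r_def)
      have "r \<le> av a" using mult_right_mono[OF 2(2), of "av a"] 2 by (simp add: r_def power2_eq_square mult_ac)
      then have X: "disc_norm av a r [:0, 1:] = av a" using r by (simp add: disc_norm_X)
      have ja: "j \<le> 1 / av a" using 2 a by (simp add: field_simps)
      show ?thesis
      proof (rule bexI[of _ "BAff (disc_norm av a r)"], rule allI)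
        fix Q show "lin_val av (BAff (disc_norm av a r)) Q = max j (chordal av P Q)"
        proof (cases Q)
          case Q: (Some c)
          consider "av c = av a" | "av c < av a" | "av c > av a" by linarith
          then have "max r (av (a - c)) / (av a * max 1 (av c)) = max j (av (a - c) / (av a * max 1 (av c)))"
          proof cases
            case 1
            then show ?thesis using 2 j a by (auto simp: r_def max_def field_simps power2_eq_square)
          next
            case c: 2
            then have "av (a - c) = av a" using av_diff[of a c] av_add[of "a - c" c] by auto
            moreover have "j \<le> 1 / max 1 (av c)"
              using c 2 by (intro order_trans[OF ja] frac_le) auto
            ultimately show ?thesis using \<open>r \<le> av a\<close> a by (simp add: max_absorb2)
          next
            case 3
            then have "av (a - c) = av c" using av_diff[of a c] av_diff[of a "a - c"] by auto
            moreover have "c \<noteq> 0" using 3 2 by auto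
            ultimately show ?thesis using \<open>r \<le> av a\<close> 2 3 ja by (simp add: max_absorb2)
          qed
          then show ?thesis using r Some Q 2
            by (simp add: disc_norm_linear X chordal_simps max_absorb2)
        qed (use r 2 Some ja in \<open>simp add: X chordal_simps max_absorb2\<close>)
      qed (use r in \<open>simp add: BAff_P1Berk disc_norm_seminorm\<close>)
    next
      \<comment> \<open>Now 1/|a| < j, so P is closer than j to infinity, and by the ultrametric
        inequality both centres give the same point.\<close>
      case 3
      obtain z where z: "z \<in> P1Berk av" "\<And>Q. lin_val av z Q = max j (chordal av None Q)"
        using inf by blast
      have "a \<noteq> 0" using 3 by auto
      then have "chordal av None P < j" using Some 3 by (simp add: chordal_simps field_simps)
      then have "max j (chordal av None Q) = max j (chordal av P Q)" for Q
        using lin_val_le[OF berk_of_P1Berk, of None Q P] lin_val_le[OF berk_of_P1Berk, of P Q None]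
        unfolding chordal_eq[symmetric] 
        by (smt (verit) chordal_commute max_def chordal_eq lin_val_le berk_of_P1Berk)
      then show ?thesis using z by auto
    qed
  qed (use inf in simp)
qed

text \<open>If j exceeds the diameter, some P has value below j at \<open>x\<close>, and above the
  cutoff the values of \<open>x\<close> agree with the chordal distance to P. Points without a
  centre thus reduce to discs around points of the projective line.\<close>

lemma truncation_exists:
  assumes x: "x \<in> P1Berk av" and j: "bdiam x \<le> j" "j \<le> 1"
  shows "\<exists>z\<in>P1Berk av. \<forall>P. lin_val av z P = max j (lin_val av x P)"
proof (cases "bdiam x = j")
  case True
  then show ?thesis using x bdiam_le[OF x] by (intro bexI[of _ x]) (auto simp: max_def)
next
  case False
  then obtain P where P: "lin_val av x P < j" using bdiam_lessD[OF x, of j] j by force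
  then have "j > 0" using lin_val_nonneg[OF x, of P] by linarith
  then obtain z where z: "z \<in> P1Berk av" "\<And>Q. lin_val av z Q = max j (chordal av P Q)"
    using disc_point_exists j by blast
  have "max j (chordal av P Q) = max j (lin_val av x Q)" for Q
    using P lin_val_le[OF x, of Q P] chordal_le[OF x, of P Q] chordal_commute[of P Q]
    by (auto simp: max_def split: if_splits)
  then show ?thesis using z by auto
qed

subsection \<open>Paths, joins and the Favre--Rivera-Letelier metric\<close>

text \<open>Off the projective line the definition divides the infimum of |T - a| by M^2, while the
  linear form at a is divided by M max(1,|a|). The infima agree because a point a with max(1,|a|)
  different from M never does better than infinity, whose value is 1/M.\<close>

lemma diam_G_eq_bdiam:
  assumes x: "x \<in> P1Berk av"
  shows "diam_G av x = bdiam x"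
proof (cases "x \<in> P1K_in av")
  case True
  then obtain P where "x = berk_of av P" unfolding P1K_in_def berk_of_def
    by (metis (no_types, lifting) imageE insertE option.simps(4,5))
  then have "lin_val av x P = 0" by (simp flip: chordal_eq)
  then have "bdiam x = 0" using bdiam_le[OF x, of P] bdiam_nonneg[OF x] by simp
  with True show ?thesis by (simp add: diam_G_def)
next
  case False
  then obtain s where xs: "x = BAff s" and s: "berk_point av s"
    using x by (auto simp: P1K_in_def elim: P1Berk_cases)
  interpret berk_point av s by fact
  define M where "M = max 1 (s [:0, 1:])"
  define I where "I = (INF a. s [:-a, 1:])"
  have M: "M \<ge> 1" "s [:0, 1:] \<le> M" by (auto simp: M_def)
  have "bdd_below (range (\<lambda>a. s [:-a, 1:]))" by (rule bdd_belowI2[of _ 0]) simp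
  then have I: "I \<le> s [:-a, 1:]" for a unfolding I_def by (rule cINF_lower) simp
  have 1: "I / M\<^sup>2 \<le> lin_val av x P" for P
  proof -
    have inf: "I / M\<^sup>2 \<le> 1 / M"
    proof -
      have "I \<le> M" using I[of 0] M by simp
      then show ?thesis using M by (simp add: field_simps power2_eq_square)
    qed
    show ?thesis
    proof (cases P)
      case None
      then show ?thesis using inf xs by (simp add: M_def)
    next
      case (Some a)
      show ?thesis
      proof (cases "av a \<le> M")
        case True
        have "I / M\<^sup>2 \<le> s [:-a, 1:] / M\<^sup>2" using I by (intro divide_right_mono) auto
        also have "\<dots> \<le> s [:-a, 1:] / (M * max 1 (av a))"
          using M True by (intro divide_left_mono) (auto simp: power2_eq_square)
        finally show ?thesis using Some xs by (simp add: M_def)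
      next
        case False
        then have "av a \<le> s [:-a, 1:]" using av_le_linear[of a] M by auto
        moreover have "a \<noteq> 0" using False M by auto
        ultimately have "1 / M \<le> s [:-a, 1:] / (M * max 1 (av a))"
          using False M by (simp add: field_simps)
        then show ?thesis using inf Some xs by (simp add: M_def)
      qed
    qed
  qed
  have "bdiam x * M\<^sup>2 \<le> I" unfolding I_def
  proof (rule cINF_greatest)
    fix a
    have "\<exists>P. lin_val av x P * M\<^sup>2 \<le> s [:-a, 1:]"
    proof (cases "max 1 (av a) = M")
      case True
      have "lin_val av x (Some a) = s [:-a, 1:] / (M * M)" by (simp add: xs True flip: M_def)
      then have "lin_val av x (Some a) * M\<^sup>2 \<le> s [:-a, 1:]"
        using M by (simp add: power2_eq_square)
      then show ?thesis by blast
    next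
      case False
      \<comment> \<open>Here |a| and |T| differ with at least one of them above 1, so |T - a| is
        their maximum.\<close>
      have "M \<le> s [:-a, 1:]"
        using False av_le_linear[of a] X_le_linear[of a] M
        by (auto simp: M_def max_def split: if_splits)
      then have "lin_val av x None * M\<^sup>2 \<le> s [:-a, 1:]"
        using M by (simp add: xs power2_eq_square flip: M_def)
      then show ?thesis by blast
    qed
    then obtain P where P: "lin_val av x P * M\<^sup>2 \<le> s [:-a, 1:]" by blast
    have "bdiam x * M\<^sup>2 \<le> lin_val av x P * M\<^sup>2"
      using bdiam_le[OF x, of P] by (intro mult_right_mono) auto
    with P show "bdiam x * M\<^sup>2 \<le> s [:-a, 1:]" by linarith
  qed simp
  then have "bdiam x \<le> I / M\<^sup>2" using M by (simp add: field_simps)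
  moreover have "I / M\<^sup>2 \<le> bdiam x" using 1 by (rule bdiam_greatest)
  ultimately show ?thesis using False by (simp add: diam_G_def xs I_def M_def)
qed

text \<open>The tree order rooted at the Gauss point.\<close>

definition lin_le :: "'k berk \<Rightarrow> 'k berk \<Rightarrow> bool" where
  "lin_le x z \<longleftrightarrow> (\<forall>P. lin_val av x P \<le> lin_val av z P)"

lemma lin_le_antisym: "x \<in> P1Berk av \<Longrightarrow> y \<in> P1Berk av \<Longrightarrow> lin_le x y \<Longrightarrow> lin_le y x \<Longrightarrow> x = y"
  by (rule lin_val_inject) (auto simp: lin_le_def intro: antisym)

section \<open>Translation between the orders rooted at infinity and at the Gauss point\<close>

lemma berk_le_trans: "berk_le s t \<Longrightarrow> berk_le t u \<Longrightarrow> berk_le s u"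
  unfolding berk_le_def by (blast intro: order_trans)

lemma berk_le_X: "berk_le s t \<Longrightarrow> s [:0, 1:] \<le> t [:0, 1:]"
  by (simp add: berk_le_def)

abbreviation gss :: "'k poly \<Rightarrow> real" where "gss \<equiv> disc_norm av 0 1"

lemma gss_seminorm: "berk_seminorm av gss" by (simp add: disc_norm_seminorm)

text \<open>The points above the Gauss point, seen from infinity, form the ray zeta_{0,r} with r >=
  1, and r is the value at T.\<close>

lemma gss_le_iff:
  assumes "berk_seminorm av u"
  shows "berk_le gss u \<longleftrightarrow> 1 \<le> u [:0, 1:] \<and> (\<forall>c. u [:-c, 1:] = max (u [:0, 1:]) (av c))"
proof -
  interpret berk_point av u by (rule berk_pointI) fact
  have iff: "berk_le gss u \<longleftrightarrow> (\<forall>c. max 1 (av c) \<le> u [:-c, 1:])"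
    unfolding berk_le_iff_linear[OF gss_seminorm assms] by (simp add: disc_norm_linear)
  show ?thesis
  proof (intro iffI conjI allI)
    assume le: "berk_le gss u"
    show "1 \<le> u [:0, 1:]" using le[unfolded iff, rule_format, of 0] by simp
    fix c
    show "u [:-c, 1:] = max (u [:0, 1:]) (av c)"
      using le[unfolded iff, rule_format, of c] linear_le_X[of c] X_le_linear[of c] by linarith
  next
    assume *: "1 \<le> u [:0, 1:] \<and> (\<forall>c. u [:-c, 1:] = max (u [:0, 1:]) (av c))"
    show "berk_le gss u" unfolding iff
    proof
      fix c
      have "u [:-c, 1:] = max (u [:0, 1:]) (av c)" using * by blast
      then show "max 1 (av c) \<le> u [:-c, 1:]" using * by linarith
    qed
  qed
qed

lemma le_disc_norm_iff:
  assumes "berk_seminorm av u" and "r > 0"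
  shows "berk_le u (disc_norm av 0 r) \<longleftrightarrow> u [:0, 1:] \<le> r"
proof -
  interpret berk_point av u by (rule berk_pointI) fact
  have "u [:-c, 1:] \<le> max r (av c)" if "u [:0, 1:] \<le> r" for c
    using that linear_le_X[of c] by auto
  then show ?thesis
    using berk_le_X[of u "disc_norm av 0 r"] assms
    unfolding berk_le_iff_linear[OF assms(1) disc_norm_seminorm[OF assms(2)]]
    by (auto simp: disc_norm_linear disc_norm_X dest: spec[of _ 0])
qed

text \<open>For |T|_s > 1 the join of \<open>s\<close> and the Gauss point in the order rooted at
  infinity is zeta_{0,r} with r = |T|_s; this is its minimality.\<close>

lemma disc_norm_least:
  assumes s: "berk_seminorm av s" "s [:0, 1:] > 1" and w: "berk_seminorm av w"
    and "berk_le s w" and "berk_le gss w"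
  shows "berk_le (disc_norm av 0 (s [:0, 1:])) w"
proof -
  have r: "s [:0, 1:] > 0" using s(2) by simp
  have "w [:-c, 1:] = max (w [:0, 1:]) (av c)" for c using assms(5) unfolding gss_le_iff[OF w] by blast
  moreover have "disc_norm av 0 (s [:0, 1:]) [:-c, 1:] = max (s [:0, 1:]) (av c)" for c
    by (simp add: disc_norm_linear[OF r])
  ultimately have "disc_norm av 0 (s [:0, 1:]) [:-c, 1:] \<le> w [:-c, 1:]" for c
    using max.mono[OF berk_le_X[OF assms(4)] order_refl] by metis
  then show ?thesis unfolding berk_le_iff_linear[OF disc_norm_seminorm[OF r] w] by blast
qed

text \<open>Towards the Gauss point, a path starting with |T|_s > 1 rises until it meets the ray of
  the points zeta_{0,r} and then descends it. The first alternative is the rising stretch, on which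
  max(1,|T|) is constant; the second is the descent strictly below the meeting point.\<close>

lemma lin_le_BAff_iff:
  assumes s: "berk_seminorm av s" and u: "berk_seminorm av u"
  shows "lin_le (BAff s) (BAff u) \<longleftrightarrow>
    (max 1 (s [:0, 1:]) = max 1 (u [:0, 1:]) \<and> berk_le s u) \<or>
    (u [:0, 1:] < s [:0, 1:] \<and> 1 < s [:0, 1:] \<and> berk_le gss u)"
proof -
  interpret s: berk_point av s by (rule berk_pointI) fact
  interpret u: berk_point av u by (rule berk_pointI) fact
  define S where "S = s [:0, 1:]"
  define U where "U = u [:0, 1:]"
  have iff: "lin_le (BAff s) (BAff u) \<longleftrightarrow> max 1 U \<le> max 1 S \<and>
    (\<forall>c. s [:-c, 1:] * max 1 U \<le> u [:-c, 1:] * max 1 S)"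
  proof -
    have "s [:-c, 1:] / (max 1 S * max 1 (av c)) \<le> u [:-c, 1:] / (max 1 U * max 1 (av c)) \<longleftrightarrow>
      s [:-c, 1:] * max 1 U \<le> u [:-c, 1:] * max 1 S" for c
    proof -
      define m n k where "m = max 1 S" and "n = max 1 U" and "k = max 1 (av c)"
      have "m > 0" "n > 0" "k > 0" by (auto simp: m_def n_def k_def)
      then show ?thesis unfolding m_def[symmetric] n_def[symmetric] k_def[symmetric]
        by (simp add: field_simps)
    qed
    moreover have "1 / max 1 S \<le> 1 / max 1 U \<longleftrightarrow> max 1 U \<le> max 1 S"
      by (auto simp: field_simps)
    ultimately show ?thesis unfolding lin_le_def split_option_all by (simp flip: S_def U_def)
  qed
  show ?thesis unfolding S_def[symmetric] U_def[symmetric]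
  proof (intro iffI)
    assume L: "lin_le (BAff s) (BAff u)"
    show "max 1 S = max 1 U \<and> berk_le s u \<or> U < S \<and> 1 < S \<and> berk_le gss u"
    proof (cases "max 1 S = max 1 U")
      case True
      then have "berk_le s u" using L unfolding iff berk_le_iff_linear[OF s u] by simp
      with True show ?thesis by simp
    next
      case False
      then have US: "U < S" "1 < S" "max 1 U < S" using L unfolding iff by auto
      \<comment> \<open>For |c| < S the value of T - c at \<open>s\<close> is at least S, so the
        order hypothesis gives the bound. For |c| >= S > U the ultrametric inequality at
        \<open>u\<close> gives it.\<close>
      have "max 1 (av c) \<le> u [:-c, 1:]" for c
      proof (cases "av c < S")
        case True
        then have "S \<le> s [:-c, 1:]" using s.X_le_linear[of c] by (auto simp: S_def)
        then have "S * max 1 U \<le> s [:-c, 1:] * max 1 U" by (intro mult_right_mono) auto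
        also have "\<dots> \<le> u [:-c, 1:] * S" using L US unfolding iff by (simp add: max_def)
        finally have "max 1 U \<le> u [:-c, 1:]" using US by (simp add: mult.commute)
        then show ?thesis using u.av_le_linear[of c] by (auto simp: U_def)
      next
        case False
        then show ?thesis using u.av_le_linear[of c] US by (auto simp: U_def)
      qed
      then have "berk_le gss u"
        unfolding berk_le_iff_linear[OF gss_seminorm u] by (simp add: disc_norm_linear)
      with US show ?thesis by simp
    qed
  next
    assume "max 1 S = max 1 U \<and> berk_le s u \<or> U < S \<and> 1 < S \<and> berk_le gss u"
    then show "lin_le (BAff s) (BAff u)"
    proof
      assume "max 1 S = max 1 U \<and> berk_le s u"
      then show ?thesis unfolding iff berk_le_iff_linear[OF s u]
        by (auto intro!: mult_right_mono)
    next
      assume *: "U < S \<and> 1 < S \<and> berk_le gss u"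
      then have U: "1 \<le> U" "\<And>c. u [:-c, 1:] = max U (av c)"
        unfolding gss_le_iff[OF u] U_def by auto
      have "s [:-c, 1:] * U \<le> u [:-c, 1:] * S" for c
      proof -
        have "s [:-c, 1:] * U \<le> max S (av c) * U"
          using s.linear_le_X[of c] U by (intro mult_right_mono) (auto simp: S_def)
        also have "\<dots> \<le> u [:-c, 1:] * S"
          using mult_max_le[of U S "av c"] U * by (simp add: mult.commute)
        finally show ?thesis .
      qed
      then show ?thesis unfolding iff using * U by simp
    qed
  qed
qed

lemma lin_le_BInf_BAff_iff:
  assumes u: "berk_seminorm av u"
  shows "lin_le BInf (BAff u) \<longleftrightarrow> berk_le gss u"
proof -
  interpret berk_point av u by (rule berk_pointI) fact
  define U where "U = u [:0, 1:]"
  have "1 / max 1 (av c) \<le> u [:-c, 1:] / (max 1 U * max 1 (av c)) \<longleftrightarrow> max 1 U \<le> u [:-c, 1:]" for c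
  proof -
    define n k where "n = max 1 U" and "k = max 1 (av c)"
    have "n > 0" "k > 0" by (auto simp: n_def k_def)
    then show ?thesis unfolding n_def[symmetric] k_def[symmetric] by (simp add: field_simps)
  qed
  then have iff: "lin_le BInf (BAff u) \<longleftrightarrow> (\<forall>c. max 1 U \<le> u [:-c, 1:])"
    unfolding lin_le_def split_option_all by (simp add: le_max_iff_disj flip: U_def)
  show ?thesis unfolding iff gss_le_iff[OF u] U_def[symmetric]
  proof (intro iffI conjI allI)
    assume le: "\<forall>c. max 1 U \<le> u [:-c, 1:]"
    show "1 \<le> U" using le[rule_format, of 0] by (simp add: U_def)
    fix c
    show "u [:-c, 1:] = max U (av c)"
      using le[rule_format, of c] av_le_linear[of c] linear_le_X[of c] unfolding U_def by linarith
  next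
    fix c
    assume *: "1 \<le> U \<and> (\<forall>c. u [:-c, 1:] = max U (av c))"
    then have "u [:-c, 1:] = max U (av c)" by blast
    then show "max 1 U \<le> u [:-c, 1:]" using * by linarith
  qed
qed

lemma lin_le_BAff_BInf: "\<not> lin_le (BAff s) BInf"
  unfolding lin_le_def by (auto simp: not_le intro!: exI[of _ None])

lemma lin_le_refl: "lin_le x x" by (simp add: lin_le_def)

lemma gss_le_linear_iff:
  assumes "berk_seminorm av u" "berk_seminorm av t" "berk_le gss u" "berk_le gss t"
  shows "berk_le t u \<longleftrightarrow> t [:0, 1:] \<le> u [:0, 1:]"
proof
  assume le: "t [:0, 1:] \<le> u [:0, 1:]"
  have "t [:-c, 1:] = max (t [:0, 1:]) (av c)" "u [:-c, 1:] = max (u [:0, 1:]) (av c)" for c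
    using assms(3,4) unfolding gss_le_iff[OF assms(1)] gss_le_iff[OF assms(2)] by blast+
  then have "t [:-c, 1:] \<le> u [:-c, 1:]" for c using max.mono[OF le order_refl] by metis
  then show "berk_le t u" unfolding berk_le_iff_linear[OF assms(2,1)] by blast
qed (rule berk_le_X)

lemma lin_le_gss_iff:
  assumes u: "berk_seminorm av u" and t: "berk_seminorm av t" and "berk_le gss u" "berk_le gss t"
  shows "lin_le (BAff u) (BAff t) \<longleftrightarrow> t [:0, 1:] \<le> u [:0, 1:]"
proof -
  have "1 \<le> u [:0, 1:]" "1 \<le> t [:0, 1:]"
    using assms(3,4) unfolding gss_le_iff[OF u] gss_le_iff[OF t] by blast+
  then show ?thesis
    unfolding lin_le_BAff_iff[OF u t] gss_le_linear_iff[OF t u assms(4,3)] using assms(4)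
    by (simp add: max_absorb2) linarith
qed

lemma lin_le_BAff_iff_large:
  assumes s: "berk_seminorm av s" "s [:0, 1:] > 1" and u: "berk_seminorm av u"
  shows "lin_le (BAff s) (BAff u) \<longleftrightarrow>
    (berk_le s u \<or> berk_le gss u) \<and> u [:0, 1:] \<le> s [:0, 1:]"
proof -
  interpret s: berk_point av s by (rule berk_pointI) fact
  have "berk_le s u" if "berk_le gss u" "u [:0, 1:] = s [:0, 1:]"
    using that s.linear_le_X unfolding gss_le_iff[OF u] berk_le_iff_linear[OF s(1) u] by simp
  moreover have "u [:0, 1:] = s [:0, 1:]" if "berk_le s u" "u [:0, 1:] \<le> s [:0, 1:]"
    using berk_le_X[OF that(1)] that(2) by simp
  moreover have "u [:0, 1:] = s [:0, 1:]" if "max 1 (s [:0, 1:]) = max 1 (u [:0, 1:])"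
    using that s by (auto simp: max_def split: if_splits)
  ultimately show ?thesis unfolding lin_le_BAff_iff[OF s(1) u] using s by (auto simp: order_less_le)
qed

text \<open>A segment consists of the points above an endpoint and below every common upper bound,
  seen from infinity. The least common upper bound of \<open>s\<close> and the Gauss point is the
  Gauss point if |T|_s <= 1 and zeta_{0,|T|_s} otherwise, whence the two cases.\<close>

lemma seg_gauss:
  assumes x: "x \<in> P1Berk av"
  shows "seg av x (gauss av) = {z \<in> P1Berk av. lin_le x z}"
  using x
proof (cases rule: P1Berk_cases)
  case Inf
  then show ?thesis unfolding gauss_eq
    by (auto simp: P1Berk_def lin_le_refl lin_le_BInf_BAff_iff)
next
  case (Aff s)
  have s: "berk_seminorm av s" using Aff by (simp add: berk_point.seminorm)
  have "(berk_le s u \<or> berk_le gss u) \<and>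
      (\<forall>w. berk_seminorm av w \<and> berk_le s w \<and> berk_le gss w \<longrightarrow> berk_le u w)
    \<longleftrightarrow> lin_le (BAff s) (BAff u)" (is "?L u \<longleftrightarrow> _") if u: "berk_seminorm av u" for u
  proof (cases "s [:0, 1:] \<le> 1")
    case True
    then have sg: "berk_le s gss" using le_disc_norm_iff[OF s, of 1] by simp
    have gg: "berk_le gss gss" by (simp add: berk_le_def)
    have "?L u \<longleftrightarrow> berk_le s u \<and> berk_le u gss"
      using sg gg gss_seminorm berk_le_trans by blast
    also have "\<dots> \<longleftrightarrow> lin_le (BAff s) (BAff u)"
      unfolding lin_le_BAff_iff[OF s u] using True le_disc_norm_iff[OF u, of 1]
      by (auto simp: max_def)
    finally show ?thesis .
  next
    case False
    then have S: "s [:0, 1:] > 1" by simp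
    let ?e = "disc_norm av 0 (s [:0, 1:])"
    have e: "berk_seminorm av ?e" using S by (simp add: disc_norm_seminorm)
    have "berk_le s ?e" "berk_le gss ?e"
      using S le_disc_norm_iff[OF s, of "s [:0, 1:]"] le_disc_norm_iff[OF gss_seminorm, of "s [:0, 1:]"]
      by (auto simp: disc_norm_X)
    then have "?L u \<longleftrightarrow> (berk_le s u \<or> berk_le gss u) \<and> berk_le u ?e"
      using disc_norm_least[OF s S] e berk_le_trans by blast
    also have "\<dots> \<longleftrightarrow> lin_le (BAff s) (BAff u)"
      unfolding lin_le_BAff_iff_large[OF s S u] using le_disc_norm_iff[OF u, of "s [:0, 1:]"] S by simp
    finally show ?thesis .
  qed
  then show ?thesis unfolding gauss_eq Aff
    by (auto simp: P1Berk_def lin_le_BAff_BInf)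
qed

text \<open>Here \<open>z\<close> lies on the path from \<open>x\<close> to the Gauss point. On its
  rising stretch the join of both ends, seen from infinity, is \<open>z\<close> itself; on its
  descending stretch it is zeta_{0,|T|_s}, the top of the path.\<close>

lemma seg_lin_le:
  assumes x: "x \<in> P1Berk av" and z: "z \<in> P1Berk av" and xz: "lin_le x z"
  shows "seg av x z = {w \<in> P1Berk av. lin_le x w \<and> lin_le w z}"
  using x
proof (cases rule: P1Berk_cases)
  case Inf
  show ?thesis
  proof (cases z)
    case BInf
    have "w = BInf" if "lin_le w BInf" for w using that lin_le_BAff_BInf by (cases w) blast+
    then show ?thesis unfolding BInf Inf using BInf_P1Berk lin_le_refl by fastforce
  next
    case (BAff t)
    then have t: "berk_seminorm av t" using z by (simp add: BAff_P1Berk)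
    have gt: "berk_le gss t" using xz BAff Inf lin_le_BInf_BAff_iff[OF t] by simp
    have "berk_le t u \<longleftrightarrow> lin_le BInf (BAff u) \<and> lin_le (BAff u) (BAff t)"
      if u: "berk_seminorm av u" for u
      using gss_le_linear_iff[OF u t _ gt] lin_le_gss_iff[OF u t _ gt] berk_le_trans[OF gt]
      unfolding lin_le_BInf_BAff_iff[OF u] by blast
    then show ?thesis using Inf BAff xz by (auto simp: P1Berk_def lin_le_refl)
  qed
next
  case (Aff s)
  have s: "berk_seminorm av s" using Aff by (simp add: berk_point.seminorm)
  obtain t where zt: "z = BAff t" using xz Aff lin_le_BAff_BInf by (cases z) auto
  have t: "berk_seminorm av t" using z zt by (simp add: BAff_P1Berk)
  have "(berk_le s u \<or> berk_le t u) \<and>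
      (\<forall>w. berk_seminorm av w \<and> berk_le s w \<and> berk_le t w \<longrightarrow> berk_le u w)
    \<longleftrightarrow> lin_le (BAff s) (BAff u) \<and> lin_le (BAff u) (BAff t)" (is "?L u \<longleftrightarrow> _")
    if u: "berk_seminorm av u" for u
  proof -
    consider "max 1 (s [:0, 1:]) = max 1 (t [:0, 1:])" "berk_le s t"
      | "t [:0, 1:] < s [:0, 1:]" "1 < s [:0, 1:]" "berk_le gss t"
      using xz unfolding Aff zt lin_le_BAff_iff[OF s t] by blast
    then show ?thesis
    proof cases
      case 1
      have tt: "berk_le t t" by (simp add: berk_le_def)
      have "?L u \<longleftrightarrow> berk_le s u \<and> berk_le u t"
        using 1 t tt berk_le_trans by blast
      also have "\<dots> \<longleftrightarrow> lin_le (BAff s) (BAff u) \<and> lin_le (BAff u) (BAff t)"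
      proof
        assume *: "berk_le s u \<and> berk_le u t"
        then have "s [:0, 1:] \<le> u [:0, 1:]" "u [:0, 1:] \<le> t [:0, 1:]" by (auto intro: berk_le_X)
        then have "max 1 (s [:0, 1:]) = max 1 (u [:0, 1:])" "max 1 (u [:0, 1:]) = max 1 (t [:0, 1:])"
          using 1 by (auto simp: max_def split: if_splits)
        then show "lin_le (BAff s) (BAff u) \<and> lin_le (BAff u) (BAff t)"
          unfolding lin_le_BAff_iff[OF s u] lin_le_BAff_iff[OF u t] using * by simp
      next
        assume "lin_le (BAff s) (BAff u) \<and> lin_le (BAff u) (BAff t)"
        then show "berk_le s u \<and> berk_le u t"
          unfolding lin_le_BAff_iff[OF s u] lin_le_BAff_iff[OF u t] using 1
          by (auto simp: max_def split: if_splits)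
      qed
      finally show ?thesis .
    next
      case 2
      let ?e = "disc_norm av 0 (s [:0, 1:])"
      have e: "berk_seminorm av ?e" using 2 by (simp add: disc_norm_seminorm)
      have "berk_le s ?e" "berk_le t ?e"
        using 2 le_disc_norm_iff[OF s, of "s [:0, 1:]"] le_disc_norm_iff[OF t, of "s [:0, 1:]"]
        by auto
      then have L: "?L u \<longleftrightarrow> (berk_le s u \<or> berk_le t u) \<and> u [:0, 1:] \<le> s [:0, 1:]"
        using disc_norm_least[OF s 2(2)] e berk_le_trans 2 le_disc_norm_iff[OF u, of "s [:0, 1:]"]
        by (smt (verit, best))
      have t1: "1 \<le> t [:0, 1:]" using 2 gss_le_iff[OF t] by blast
      show ?thesis
      proof
        assume "?L u"
        then have *: "berk_le s u \<or> berk_le t u" "u [:0, 1:] \<le> s [:0, 1:]" using L by auto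
        then have "lin_le (BAff s) (BAff u)"
          unfolding lin_le_BAff_iff_large[OF s 2(2) u] using 2 berk_le_trans by blast
        moreover have "lin_le (BAff u) (BAff t)"
        proof (cases "berk_le t u")
          case True
          then show ?thesis
            using lin_le_gss_iff[OF u t berk_le_trans[OF 2(3) True] 2(3)] berk_le_X by blast
        next
          case False
          then have "s [:0, 1:] \<le> u [:0, 1:]" using * berk_le_X by blast
          then show ?thesis unfolding lin_le_BAff_iff[OF u t] using 2 by linarith
        qed
        ultimately show "lin_le (BAff s) (BAff u) \<and> lin_le (BAff u) (BAff t)" by blast
      next
        assume *: "lin_le (BAff s) (BAff u) \<and> lin_le (BAff u) (BAff t)"
        then have "(berk_le s u \<or> berk_le gss u)" and us: "u [:0, 1:] \<le> s [:0, 1:]"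
          unfolding lin_le_BAff_iff_large[OF s 2(2) u] by auto
        then have "berk_le s u \<or> berk_le t u"
          using * lin_le_gss_iff[OF u t _ 2(3)] gss_le_linear_iff[OF u t _ 2(3)] by blast
        then show "?L u" using L us by blast
      qed
    qed
  qed
  then show ?thesis using Aff zt by (auto simp: P1Berk_def lin_le_BAff_BInf)
qed

section \<open>The join as a truncation, and the Favre--Rivera-Letelier distance\<close>

lemma bjoin_truncation:
  assumes x: "x \<in> P1Berk av" and y: "y \<in> P1Berk av"
    and w: "\<And>P. lin_val av w P = max (bjoin x y) (lin_val av x P)"
  shows "lin_val av w P = max (bjoin x y) (lin_val av y P)"
proof -
  have "lin_val av x P \<le> max (bjoin x y) (lin_val av y P)"
    "lin_val av y P \<le> max (bjoin x y) (lin_val av x P)"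
    using lin_val_le_bjoin[OF x y] lin_val_le_bjoin[OF y x] by (auto simp only: bjoin_commute)
  then show ?thesis unfolding w by (intro antisym) auto
qed

lemma bdiam_truncation:
  assumes x: "x \<in> P1Berk av" and w: "w \<in> P1Berk av" and "bdiam x \<le> j"
    and eq: "\<And>P. lin_val av w P = max j (lin_val av x P)"
  shows "bdiam w = j"
proof (rule antisym)
  show "j \<le> bdiam w" by (rule bdiam_greatest) (simp add: eq)
  show "bdiam w \<le> j"
  proof (rule dense_ge)
    fix e assume e: "j < e"
    then obtain P where "lin_val av x P < e" using bdiam_lessD[OF x, of e] assms(3) by force
    then show "bdiam w \<le> e" using bdiam_le[OF w, of P] eq[of P] e by linarith
  qed
qed

text \<open>The truncation is the least common upper bound of \<open>x\<close> and \<open>y\<close>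
  in the order rooted at the Gauss point, since an upper bound has all its values at least
  \<open>bjoin x y\<close>. Leastness shows both that \<open>w\<close> is a first meeting point and
  that there is no other.\<close>

lemma join_G_truncation:
  assumes x: "x \<in> P1Berk av" and y: "y \<in> P1Berk av" and w: "w \<in> P1Berk av"
    and eq: "\<And>P. lin_val av w P = max (bjoin x y) (lin_val av x P)"
  shows "join_G av x y = w"
proof -
  have xw: "lin_le x w" by (simp add: lin_le_def eq)
  have yw: "lin_le y w" by (simp add: lin_le_def bjoin_truncation[OF x y eq])
  have least: "lin_le w v" if v: "v \<in> P1Berk av" and "lin_le x v" "lin_le y v" for v
  proof -
    have "bjoin x y \<le> lin_val av v P" for P
      using bjoin_le[OF x, of y P] that unfolding lin_le_def by (smt (verit, best))
    then show ?thesis using that by (simp add: lin_le_def eq)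
  qed
  show ?thesis unfolding join_G_def
  proof (rule the_equality)
    have "v = w" if "v \<in> P1Berk av" "lin_le x v" "lin_le v w" "lin_le y v" for v
      using lin_le_antisym[OF that(1) w that(3)] least[OF that(1,2,4)] by blast
    then show "w \<in> seg av x (gauss av) \<and> seg av x w \<inter> seg av y (gauss av) = {w}"
      unfolding seg_gauss[OF x] seg_gauss[OF y] seg_lin_le[OF x w xw]
      using w xw yw lin_le_refl by auto
  next
    fix z assume *: "z \<in> seg av x (gauss av) \<and> seg av x z \<inter> seg av y (gauss av) = {z}"
    then have z: "z \<in> P1Berk av" "lin_le x z" unfolding seg_gauss[OF x] by auto
    have *: "{w \<in> P1Berk av. lin_le x w \<and> lin_le w z} \<inter> {w \<in> P1Berk av. lin_le y w} = {z}"
      using * unfolding seg_gauss[OF y] seg_lin_le[OF x z] by blast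
    then have "lin_le y z" by blast
    then have "lin_le w z" using least z by blast
    then have "w \<in> {w \<in> P1Berk av. lin_le x w \<and> lin_le w z} \<inter> {w \<in> P1Berk av. lin_le y w}"
      using w xw yw by simp
    then show "z = w" unfolding * by simp
  qed
qed

lemma frl_dist_eq_bdist:
  assumes x: "x \<in> P1Berk av" and y: "y \<in> P1Berk av"
  shows "frl_dist av x y = bdist x y"
proof -
  obtain w where w: "w \<in> P1Berk av" "\<And>P. lin_val av w P = max (bjoin x y) (lin_val av x P)"
    using truncation_exists[OF x bdiam_le_bjoin[OF x] bjoin_le_1[OF x y]] by blast
  have "diam_G av (join_G av x y) = bjoin x y"
    using join_G_truncation[OF x y w] diam_G_eq_bdiam[OF w(1)]
      bdiam_truncation[OF x w(1) bdiam_le_bjoin[OF x] w(2)] by simp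
  then show ?thesis by (simp add: frl_dist_def bdist_def diam_G_eq_bdiam x y)
qed

subsection \<open>Forms and the resultant\<close>

text \<open>The polynomial is homogenised to degree \<open>d\<close> and evaluated at homogeneous
  coordinates of norm one. Hence the exponent is \<open>d\<close> and not the degree of
  \<open>p\<close>, and at infinity only the coefficient of X^d survives.\<close>

fun form_val :: "nat \<Rightarrow> 'k berk \<Rightarrow> 'k poly \<Rightarrow> real" where
  "form_val d (BAff s) p = s p / max 1 (s [:0, 1:]) ^ d"
| "form_val d BInf p = av (coeff p d)"

context
  fixes x assumes x: "x \<in> P1Berk av"
begin

lemma form_val_nonneg: "form_val d x p \<ge> 0"
  using x by (cases rule: P1Berk_cases) (auto simp: berk_point.nonneg)

lemma form_val_smult: "form_val d x (smult c p) = av c * form_val d x p"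
  using x by (cases rule: P1Berk_cases) (auto simp: berk_point.smult)

lemma form_val_minus: "form_val d x (- p) = form_val d x p"
  using form_val_smult[of d "-1" p] by simp

lemma form_val_zero: "form_val d x 0 = 0"
  using form_val_smult[of d 0 0] by simp

lemma form_val_add: "form_val d x (p + q) \<le> max (form_val d x p) (form_val d x q)"
  using x
proof (cases rule: P1Berk_cases)
  case (Aff s)
  interpret berk_point av s by fact
  show ?thesis unfolding Aff form_val.simps by (rule divide_le_max) (auto simp: add)
qed (simp add: av_add)

lemma form_val_diff: "form_val d x (p - q) \<le> max (form_val d x p) (form_val d x q)"
  using form_val_add[of d p "-q"] by (simp add: form_val_minus)

lemma form_val_sum_le:
  assumes "\<And>i. i \<in> A \<Longrightarrow> form_val d x (h i) \<le> M" and "M \<ge> 0"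
  shows "form_val d x (sum h A) \<le> M"
  using assms
proof (induction A rule: infinite_finite_induct)
  case (insert i F)
  then have "form_val d x (sum h F) \<le> M" "form_val d x (h i) \<le> M" by auto
  then show ?case using form_val_add[of d "h i" "sum h F"] insert.hyps by simp
qed (auto simp: form_val_zero)

lemma form_val_const: "form_val d x [:c:] = av c * lin_val av x None ^ d"
  using x
proof (cases rule: P1Berk_cases)
  case Inf
  then show ?thesis by (cases d) (auto simp: coeff_pCons)
next
  case (Aff s)
  then show ?thesis by (auto simp: berk_point.const power_divide)
qed

lemma form_val_linear_mult:
  assumes "degree q \<le> d"
  shows "form_val (Suc d) x ([:-a, 1:] * q) = lin_val av x (Some a) * max 1 (av a) * form_val d x q"
  using x
proof (cases rule: P1Berk_cases)
  case Inf
  have "coeff q (Suc d) = 0" using assms by (simp add: coeff_eq_0)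
  then show ?thesis using Inf by simp
next
  case (Aff s)
  then show ?thesis by (simp add: berk_point.mult del: mult_pCons_left mult_pCons_right)
qed

lemma form_val_X_mult: "degree q \<le> d \<Longrightarrow> form_val (Suc d) x ([:0, 1:] * q) \<le> form_val d x q"
  using form_val_linear_mult[of q d 0] lin_val_le_1[OF x, of "Some 0"] form_val_nonneg[of d q]
    mult_right_mono[of "lin_val av x (Some 0)" 1 "form_val d x q"] by simp

text \<open>This is multiplication by X^e Y^(n-e), whose factors have value at most one at
  normalised coordinates. The induction peels off a Y if \<open>e = 0\<close> and an X
  otherwise.\<close>

lemma form_val_monom_mult:
  "degree q \<le> d \<Longrightarrow> e \<le> n \<Longrightarrow> form_val (d + n) x (monom 1 e * q) \<le> form_val d x q"
proof (induction n arbitrary: e)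
  case 0
  then show ?case by (simp add: monom_0 flip: pCons_one)
next
  case (Suc n)
  show ?case
  proof (cases e)
    case 0
    have "form_val (Suc (d + n)) x q \<le> form_val (d + n) x q"
      using x
    proof (cases rule: P1Berk_cases)
      case Inf
      then show ?thesis using Suc.prems by (simp add: coeff_eq_0)
    next
      case (Aff s)
      interpret berk_point av s by fact
      show ?thesis unfolding Aff form_val.simps
        by (intro divide_left_mono power_increasing) (auto intro: less_le_trans[OF zero_less_one])
    qed
    then show ?thesis using Suc.IH[of 0] Suc.prems 0 by (simp add: monom_0 flip: pCons_one)
  next
    case (Suc e')
    have "degree (monom 1 e' * q) \<le> d + n"
      using Suc.prems Suc by (intro order_trans[OF degree_mult_le]) (auto simp: degree_monom_eq)
    then have "form_val (Suc (d + n)) x ([:0, 1:] * (monom 1 e' * q)) \<le> form_val (d + n) x (monom 1 e' * q)"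
      by (rule form_val_X_mult)
    then show ?thesis using Suc.IH[of e'] Suc.prems Suc by (simp add: monom_Suc)
  qed
qed

end

text \<open>A form of degree \<open>d\<close> is a constant times \<open>d\<close> linear forms,
  copies of Y filling up the missing degree, and each contributes a factor \<open>k\<close>. This is
  where the degree of the map enters the hyperbolic estimate.\<close>

lemma form_val_mono:
  assumes x: "x \<in> P1Berk av" and y: "y \<in> P1Berk av"
    and le: "\<And>P. lin_val av x P \<le> k * lin_val av y P" and k: "k \<ge> 0" and "degree p \<le> d"
  shows "form_val d x p \<le> k ^ d * form_val d y p"
  using \<open>degree p \<le> d\<close>
proof (induction p arbitrary: d rule: closed_poly_induct)
  case zero
  then show ?case by (simp add: form_val_zero x y)
next
  case (const c)
  have "lin_val av x None ^ d \<le> k ^ d * lin_val av y None ^ d"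
    unfolding power_mult_distrib[symmetric] by (intro power_mono le lin_val_nonneg x)
  then show ?case by (simp add: form_val_const x y mult.left_commute mult_left_mono)
next
  case (linear a q)
  have "degree ([:-a, 1:] * q) = Suc (degree q)" using linear.hyps by (subst degree_mult_eq) auto
  then obtain e where d: "d = Suc e" "degree q \<le> e" using linear.prems by (cases d) auto
  have "lin_val av x (Some a) * form_val e x q \<le> (k * lin_val av y (Some a)) * (k ^ e * form_val e y q)"
    using linear.IH[OF d(2)] k
    by (intro mult_mono le) (auto simp: x y form_val_nonneg lin_val_nonneg)
  then have "max 1 (av a) * (lin_val av x (Some a) * form_val e x q)
      \<le> max 1 (av a) * ((k * lin_val av y (Some a)) * (k ^ e * form_val e y q))"
    by (intro mult_left_mono) auto
  then show ?case
    unfolding d(1) form_val_linear_mult[OF x d(2)] form_val_linear_mult[OF y d(2)] by (simp add: mult_ac)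
qed

section \<open>Integrality, Bezout identities and nonvanishing for the Sylvester matrix\<close>

lemma av_det_le_1:
  assumes "A \<in> carrier_mat n n" and "\<And>i j. i < n \<Longrightarrow> j < n \<Longrightarrow> av (A $$ (i, j)) \<le> 1"
  shows "av (det A) \<le> 1"
  unfolding det_def'[OF assms(1)]
proof (rule av_sum_le)
  fix p assume p: "p \<in> {p. p permutes {0..<n}}"
  have "(\<Prod>i = 0..<n. av (A $$ (i, p i))) \<le> 1"
    using p by (intro prod_le_1) (auto intro!: assms(2) simp: permutes_in_image
        dest: permutes_in_image[of p "{0..<n}"])
  then show "av (signof p * (\<Prod>i = 0..<n. A $$ (i, p i))) \<le> 1"
    by (auto simp: av_prod sign_def)
qed simp

end

text \<open>Row \<open>i\<close> of the Sylvester matrix, read as a polynomial of degree below $2d$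
  whose coefficient of $T^{2d-1-j}$ is the entry in column \<open>j\<close>.\<close>

definition sylv_row :: "nat \<Rightarrow> 'k::field poly \<Rightarrow> 'k poly \<Rightarrow> nat \<Rightarrow> 'k poly" where
  "sylv_row d f g i = (if i < d then monom 1 (d - 1 - i) * f else monom 1 (2 * d - 1 - i) * g)"

lemma coeff_sum_monom_rev:
  fixes v :: "nat \<Rightarrow> 'k::comm_monoid_add"
  assumes "i < n"
  shows "coeff (\<Sum>i<n. monom (v i) (n - 1 - i)) (n - 1 - i) = v i"
proof -
  have "coeff (\<Sum>i<n. monom (v i) (n - 1 - i)) (n - 1 - i) = (\<Sum>j<n. if j = i then v j else 0)"
    unfolding coeff_sum using assms by (intro sum.cong) (auto simp: coeff_monom)
  then show ?thesis using assms by simp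
qed

context
  fixes d :: nat and f g :: "'k::field poly"
  assumes d: "d \<ge> 1" and degf: "degree f \<le> d" and degg: "degree g \<le> d"
begin

lemma coeff_sylv_row:
  assumes "i < 2 * d" and "j < 2 * d"
  shows "coeff (sylv_row d f g i) (2 * d - 1 - j) = sylvester_mat_sub d d f g $$ (i, j)"
  using assms degf degg
  by (subst sylvester_mat_sub_index)
    (auto simp: sylv_row_def coeff_monom_mult not_le intro!: coeff_eq_0 arg_cong[where f = "coeff _"])

lemma degree_sylv_row: "i < 2 * d \<Longrightarrow> degree (sylv_row d f g i) \<le> 2 * d - 1"
  using d degf degg unfolding sylv_row_def
  by (auto intro!: order_trans[OF degree_mult_le] simp: degree_monom_eq)

lemma sylv_row_sum_eqI:
  assumes "\<And>j. j < 2 * d \<Longrightarrow> (\<Sum>i<2 * d. v i * sylvester_mat_sub d d f g $$ (i, j)) = coeff p (2 * d - 1 - j)"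
    and "degree p \<le> 2 * d - 1"
  shows "(\<Sum>i<2 * d. smult (v i) (sylv_row d f g i)) = p"
proof (rule poly_eqI)
  fix n
  show "coeff (\<Sum>i<2 * d. smult (v i) (sylv_row d f g i)) n = coeff p n"
  proof (cases "n < 2 * d")
    case True
    define j where "j = 2 * d - 1 - n"
    have j: "j < 2 * d" "n = 2 * d - 1 - j" using True by (auto simp: j_def)
    show ?thesis unfolding j(2) assms(1)[OF j(1), symmetric] coeff_sum coeff_smult
      by (intro sum.cong refl) (simp only: coeff_sylv_row[OF _ j(1)] lessThan_iff)
  next
    case False
    then have "coeff (sylv_row d f g i) n = 0" if "i < 2 * d" for i
      using degree_sylv_row[OF that] d by (intro coeff_eq_0) linarith
    moreover have "coeff p n = 0" using False assms(2) d by (intro coeff_eq_0) linarith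
    ultimately show ?thesis by (simp add: coeff_sum)
  qed
qed

text \<open>Row \<open>k\<close> of adj(S) S = det(S) I, read as a polynomial: a combination of F
  and G with cofactors as coefficients that equals Res times a monomial of degree 2d - 1.\<close>

lemma Res_hom_bezout:
  assumes "k < 2 * d"
  shows "(\<Sum>i<2 * d. smult (adj_mat (sylvester_mat_sub d d f g) $$ (k, i)) (sylv_row d f g i))
    = monom (Res_hom d f g) (2 * d - 1 - k)"
proof (rule sylv_row_sum_eqI)
  let ?S = "sylvester_mat_sub d d f g"
  have S: "?S \<in> carrier_mat (2 * d) (2 * d)" using sylvester_mat_sub_carrier[of d d f g] by (simp add: mult_2)
  note adj = adj_mat[OF S]
  fix j assume j: "j < 2 * d"
  have "(\<Sum>i<2 * d. adj_mat ?S $$ (k, i) * ?S $$ (i, j)) = (adj_mat ?S * ?S) $$ (k, j)"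
    using S adj(1) assms j by (auto simp: scalar_prod_def lessThan_atLeast0 intro!: sum.cong)
  also have "\<dots> = (if k = j then Res_hom d f g else 0)"
    unfolding adj(3) using assms j by (simp add: Res_hom_def resultant_sub_def)
  also have "\<dots> = coeff (monom (Res_hom d f g) (2 * d - 1 - k)) (2 * d - 1 - j)"
    using assms j by (auto simp: coeff_monom)
  finally show "(\<Sum>i<2 * d. adj_mat ?S $$ (k, i) * ?S $$ (i, j)) =
    coeff (monom (Res_hom d f g) (2 * d - 1 - k)) (2 * d - 1 - j)" .
qed (rule order_trans[OF degree_monom_le], simp)

end

context nonarch_closed begin

lemma coprime_no_common_root:
  fixes f g :: "'k poly"
  assumes "coprime f g" and "poly f a = 0"
  shows "poly g a \<noteq> 0"
proof
  assume "poly g a = 0"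
  then have "is_unit [:-a, 1:]" using assms unfolding poly_eq_0_iff_dvd by (blast intro: coprime_common_divisor)
  then show False by (simp add: is_unit_iff_degree)
qed

text \<open>Root by root: a zero of \<open>f\<close> is a zero of B g but not of g, hence of B;
  cancelling the linear factor leaves the same situation for the quotient.\<close>

lemma dvd_mult_cancel_no_common_root:
  fixes f g B :: "'k poly"
  assumes "f dvd B * g" and "\<And>a. poly f a = 0 \<Longrightarrow> poly g a \<noteq> 0"
  shows "f dvd B"
  using assms
proof (induction f arbitrary: B rule: closed_poly_induct)
  case zero
  then have "g \<noteq> 0" by auto
  then show ?case using zero.prems(1) by simp
next
  case (const c)
  then show ?case by (simp add: const_poly_dvd_iff dvd_field_iff)
next
  case (linear a q)
  have "poly (B * g) a = 0" using dvd_mult_left[OF linear.prems(1)] poly_eq_0_iff_dvd by blast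
  then have "poly B a = 0" using linear.prems(2)[of a] by simp
  then obtain B' where B: "B = [:-a, 1:] * B'" using poly_eq_0_iff_dvd by blast
  have "q dvd B' * g" using linear.prems(1) unfolding B mult.assoc by (subst (asm) dvd_mult_cancel_left) simp
  then have "q dvd B'" by (rule linear.IH) (use linear.prems(2) in auto)
  then show ?case unfolding B by (intro mult_dvd_mono) auto
qed

text \<open>A singular matrix gives a relation A f + B g = 0 with A, B of degree below
  \<open>d\<close> and not both zero. Whichever of \<open>f\<close>, \<open>g\<close> has full
  degree divides the multiplier of the other, which is too small for that. The full degree excludes
  a common zero at infinity.\<close>

lemma Res_hom_nonzero:
  fixes f g :: "'k poly"
  assumes d: "d \<ge> 1" and degf: "degree f \<le> d" and degg: "degree g \<le> d"
    and cop: "coprime f g" and top: "degree f = d \<or> degree g = d"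
  shows "Res_hom d f g \<noteq> 0"
proof
  let ?S = "sylvester_mat_sub d d f g"
  have S: "?S \<in> carrier_mat (2 * d) (2 * d)" using sylvester_mat_sub_carrier[of d d f g] by (simp add: mult_2)
  assume "Res_hom d f g = 0"
  then have "det (transpose_mat ?S) = 0"
    using det_transpose[OF S] by (simp add: Res_hom_def resultant_sub_def)
  then obtain v where v: "v \<in> carrier_vec (2 * d)" "v \<noteq> 0\<^sub>v (2 * d)"
    "transpose_mat ?S *\<^sub>v v = 0\<^sub>v (2 * d)"
    using det_0_iff_vec_prod_zero_field[of "transpose_mat ?S" "2 * d"] S by auto
  have "(\<Sum>i<2 * d. v $ i * ?S $$ (i, j)) = 0" if j: "j < 2 * d" for j
  proof -
    have "(transpose_mat ?S *\<^sub>v v) $ j = (\<Sum>i<2 * d. v $ i * ?S $$ (i, j))"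
      using S v(1) j by (auto simp: scalar_prod_def lessThan_atLeast0 mult.commute intro!: sum.cong)
    then show ?thesis using v(3) j by simp
  qed
  then have zero: "(\<Sum>i<2 * d. smult (v $ i) (sylv_row d f g i)) = 0"
    by (intro sylv_row_sum_eqI[OF d degf degg]) auto
  define A where "A = (\<Sum>i<d. monom (v $ i) (d - 1 - i))"
  define B where "B = (\<Sum>i<d. monom (v $ (d + i)) (d - 1 - i))"
  have "(\<Sum>i<2 * d. smult (v $ i) (sylv_row d f g i)) =
    (\<Sum>i<d. smult (v $ i) (sylv_row d f g i)) + (\<Sum>i<d. smult (v $ (d + i)) (sylv_row d f g (d + i)))"
    using sum.atLeastLessThan_concat[of 0 d "2 * d" "\<lambda>i. smult (v $ i) (sylv_row d f g i)"]
      sum.shift_bounds_nat_ivl[of "\<lambda>i. smult (v $ i) (sylv_row d f g i)" 0 d d]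
    by (simp add: lessThan_atLeast0 mult_2 add.commute)
  also have "\<dots> = A * f + B * g"
    unfolding A_def B_def sum_distrib_right
    by (intro arg_cong2[where f = "(+)"] sum.cong) (auto simp: sylv_row_def mult_2 smult_monom
        simp flip: mult_smult_left)
  finally have AB: "A * f + B * g = 0" using zero by simp
  have deg: "degree A < d" "degree B < d"
    unfolding A_def B_def using d
    by (auto intro!: degree_sum_less le_less_trans[OF degree_monom_le])
  have "A = 0 \<and> B = 0" using top
  proof
    assume f: "degree f = d"
    have "f dvd B * g" using AB by (metis add_eq_0_iff dvd_minus_iff dvd_triv_right)
    then have "f dvd B" using coprime_no_common_root[OF cop] by (rule dvd_mult_cancel_no_common_root)
    then have "B = 0" using deg f by (metis dvd_imp_degree_le not_le)
    moreover have "f \<noteq> 0" using f d by auto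
    ultimately show ?thesis using AB by simp
  next
    assume g: "degree g = d"
    have "g dvd A * f" using AB by (metis add_eq_0_iff2 dvd_minus_iff dvd_triv_right)
    then have "g dvd A" using coprime_no_common_root[OF cop] by (auto intro: dvd_mult_cancel_no_common_root)
    then have "A = 0" using deg g by (metis dvd_imp_degree_le not_le)
    moreover have "g \<noteq> 0" using g d by auto
    ultimately show ?thesis using AB by simp
  qed
  then have "v $ i = 0" if "i < 2 * d" for i
    using coeff_sum_monom_rev[of i d "\<lambda>i. v $ i"] coeff_sum_monom_rev[of "i - d" d "\<lambda>i. v $ (d + i)"] that
    unfolding A_def B_def by (cases "i < d") auto
  then have "v = 0\<^sub>v (2 * d)" using v(1) by auto
  with v(2) show False by simp
qed

end

subsection \<open>Composition with a rational function\<close>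

text \<open>Fixing the homogenisation degree \<open>n\<close> makes the operation linear in
  \<open>h\<close>, which \<open>hcomp\<close> is not, as its exponent changes with the degree of
  \<open>h\<close>.\<close>

definition hcomp_deg :: "nat \<Rightarrow> 'k::field poly \<Rightarrow> 'k poly \<Rightarrow> 'k poly \<Rightarrow> 'k poly" where
  "hcomp_deg n f g h = (\<Sum>i\<le>n. smult (coeff h i) (f ^ i * g ^ (n - i)))"

lemma hcomp_deg_add: "hcomp_deg n f g (p + q) = hcomp_deg n f g p + hcomp_deg n f g q"
  by (simp add: hcomp_deg_def smult_add_left sum.distrib)

lemma hcomp_deg_smult: "hcomp_deg n f g (smult c p) = smult c (hcomp_deg n f g p)"
  by (simp add: hcomp_deg_def smult_sum2)

lemma hcomp_deg_eq_hcomp: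
  assumes "degree h \<le> n"
  shows "hcomp_deg n f g h = g ^ (n - degree h) * hcomp f g h"
proof -
  have "hcomp_deg n f g h = (\<Sum>i\<le>degree h. smult (coeff h i) (f ^ i * g ^ (n - i)))"
    unfolding hcomp_deg_def using assms by (intro sum.mono_neutral_right) (auto simp: coeff_eq_0)
  also have "\<dots> = (\<Sum>i\<le>degree h. g ^ (n - degree h) * smult (coeff h i) (f ^ i * g ^ (degree h - i)))"
  proof (rule sum.cong)
    fix i assume "i \<in> {..degree h}"
    then have "g ^ (n - i) = g ^ (n - degree h) * g ^ (degree h - i)"
      using assms by (simp flip: power_add)
    then show "smult (coeff h i) (f ^ i * g ^ (n - i))
      = g ^ (n - degree h) * smult (coeff h i) (f ^ i * g ^ (degree h - i))"
      by (simp add: mult_ac)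
  qed simp
  finally show ?thesis by (simp add: hcomp_def sum_distrib_left)
qed

lemma hcomp_deg_pCons:
  "hcomp_deg (Suc n) f g (pCons c p) = smult c (g ^ Suc n) + f * hcomp_deg n f g p"
  unfolding hcomp_deg_def by (subst sum.atMost_Suc_shift) (simp add: sum_distrib_left mult_ac)

lemma hcomp_deg_mult:
  assumes "degree p \<le> n" and q: "degree q \<le> m"
  shows "hcomp_deg (n + m) f g (p * q) = hcomp_deg n f g p * hcomp_deg m f g q"
  using assms(1)
proof (induction n arbitrary: p)
  case 0
  then obtain c where "p = [:c:]" by (metis degree_eq_zeroE le_zero_eq)
  then show ?case by (simp add: hcomp_deg_smult) (simp add: hcomp_deg_def)
next
  case (Suc n)
  obtain c p' where p: "p = pCons c p'" by (cases p)
  then have p': "degree p' \<le> n" using Suc.prems by (cases "p' = 0") auto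
  have "hcomp_deg (Suc n + m) f g q = g ^ Suc n * hcomp_deg m f g q"
    using q hcomp_deg_eq_hcomp[of q "Suc n + m" f g] hcomp_deg_eq_hcomp[of q m f g]
    by (simp add: Suc_diff_le mult_ac flip: power_add)
  then have "hcomp_deg (Suc n + m) f g (p * q)
      = smult c (g ^ Suc n * hcomp_deg m f g q) + hcomp_deg (Suc (n + m)) f g (pCons 0 (p' * q))"
    by (simp add: p hcomp_deg_add hcomp_deg_smult)
  also have "hcomp_deg (Suc (n + m)) f g (pCons 0 (p' * q)) = f * (hcomp_deg n f g p' * hcomp_deg m f g q)"
    by (simp only: hcomp_deg_pCons Suc.IH[OF p']) simp
  also have "smult c (g ^ Suc n * hcomp_deg m f g q) + f * (hcomp_deg n f g p' * hcomp_deg m f g q)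
      = hcomp_deg (Suc n) f g p * hcomp_deg m f g q"
    unfolding p hcomp_deg_pCons by (simp add: algebra_simps)
  finally show ?case .
qed

lemma hcomp_mult: "p \<noteq> 0 \<Longrightarrow> q \<noteq> 0 \<Longrightarrow> hcomp f g (p * q) = hcomp f g p * hcomp f g q"
  using hcomp_deg_mult[of p "degree p" q "degree q" f g]
    hcomp_deg_eq_hcomp[of "p * q" "degree p + degree q" f g]
    hcomp_deg_eq_hcomp[of p "degree p" f g] hcomp_deg_eq_hcomp[of q "degree q" f g]
  by (simp add: degree_mult_eq)

lemma hcomp_linear: "hcomp f g [:-b, 1:] = f - smult b g"
  by (simp add: hcomp_def)

lemma poly_hcomp:
  assumes "poly g a \<noteq> 0"
  shows "poly (hcomp f g h) a = poly g a ^ degree h * poly h (poly f a / poly g a)"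
  unfolding hcomp_def poly_sum poly_altdef[of h] sum_distrib_left
  using assms by (intro sum.cong) (auto simp: power_divide power_diff)

context nonarch_closed begin

text \<open>Multiplicativity is read off at the exact degrees, the triangle inequality at a common
  homogenisation degree. Dividing by the matching power of \<open>s g\<close> makes the choice
  immaterial.\<close>

lemma hcomp_seminorm:
  assumes "berk_seminorm av s" and g: "s g \<noteq> 0"
  shows "berk_seminorm av (\<lambda>h. s (hcomp f g h) / s g ^ degree h)"
proof -
  interpret berk_point av s by (rule berk_pointI) fact
  define t where "t = (\<lambda>h. s (hcomp f g h) / s g ^ degree h)"
  have t: "t h = s (hcomp_deg n f g h) / s g ^ n" if "degree h \<le> n" for h n
    using that g unfolding t_def by (simp add: hcomp_deg_eq_hcomp mult power power_diff)
  have "t (p * q) = t p * t q" for p q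
  proof (cases "p = 0 \<or> q = 0")
    case True
    then show ?thesis by (auto simp: t_def hcomp_def)
  next
    case False
    then show ?thesis by (simp add: t_def hcomp_mult mult degree_mult_eq power_add)
  qed
  moreover have "t (p + q) \<le> t p + t q" for p q
  proof -
    define n where "n = max (degree p) (degree q)"
    have "t (p + q) = s (hcomp_deg n f g p + hcomp_deg n f g q) / s g ^ n"
      using t[of "p + q" n] degree_add_le_max[of p q] by (simp add: n_def hcomp_deg_add)
    also have "\<dots> \<le> (s (hcomp_deg n f g p) + s (hcomp_deg n f g q)) / s g ^ n"
      by (intro divide_right_mono add_le) simp
    also have "\<dots> = t p + t q" using t[of p n] t[of q n] by (simp add: n_def add_divide_distrib)
    finally show ?thesis .
  qed
  moreover have "t [:c:] = av c" for c by (simp add: t_def hcomp_def)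
  ultimately show ?thesis unfolding berk_seminorm_def t_def by simp
qed

section \<open>Variation of a form near a point of the projective line\<close>

lemma (in berk_point) X_power_diff_le:
  assumes "n \<ge> 1"
  shows "s (monom 1 n - [:a ^ n:]) \<le> s [:-a, 1:] * max (s [:0, 1:]) (av a) ^ (n - 1)"
proof -
  let ?m = "max (s [:0, 1:]) (av a)"
  have "monom 1 n - [:a ^ n:] = [:0, 1:] ^ n - [:a:] ^ n"
    by (simp add: monom_altdef poly_const_pow)
  also have "\<dots> = [:-a, 1:] * (\<Sum>i<n. [:a:] ^ (n - Suc i) * [:0, 1:] ^ i)"
    by (subst power_diff_sumr2) simp
  finally have "s (monom 1 n - [:a ^ n:]) = s [:-a, 1:] * s (\<Sum>i<n. [:a:] ^ (n - Suc i) * [:0, 1:] ^ i)"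
    by (simp only: mult)
  also have "\<dots> \<le> s [:-a, 1:] * ?m ^ (n - 1)"
  proof (intro mult_left_mono sum_le_max)
    fix i assume i: "i \<in> {..<n}"
    have "s ([:a:] ^ (n - Suc i) * [:0, 1:] ^ i) \<le> ?m ^ (n - Suc i) * ?m ^ i"
      unfolding mult power by (intro mult_mono power_mono) (auto simp: le_max_iff_disj)
    also have "\<dots> = ?m ^ (n - 1)" using i by (simp flip: power_add)
    finally show "s ([:a:] ^ (n - Suc i) * [:0, 1:] ^ i) \<le> ?m ^ (n - 1)" .
  qed (auto simp: le_max_iff_disj)
  finally show ?thesis .
qed

lemma (in berk_point) monom: "s (monom c n) = av c * s [:0, 1:] ^ n"
  by (simp add: monom_altdef power)

text \<open>The coordinates used are (a : 1) and (1 : 0), without rescaling when |a| > 1; the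
  matching choice of \<open>unit_form\<close> compensates for this.\<close>

definition form_eval :: "nat \<Rightarrow> 'k poly \<Rightarrow> 'k option \<Rightarrow> 'k" where
  "form_eval d p P = (case P of None \<Rightarrow> coeff p d | Some a \<Rightarrow> poly p a)"

text \<open>A form of degree \<open>d\<close> with value one at the given point, and sup norm at most one.\<close>

definition unit_form :: "nat \<Rightarrow> 'k option \<Rightarrow> 'k poly" where
  "unit_form d P = (case P of None \<Rightarrow> monom 1 d
     | Some a \<Rightarrow> if av a \<le> 1 then 1 else monom (1 / a ^ d) d)"

text \<open>The difference vanishes at P, so the linear form at P splits off, and the remaining
  factor is bounded by one. At infinity the linear form is Y; for finite a it comes from factoring a
  difference of powers T^n - a^n.\<close>

lemma form_val_monom_diff:
  assumes x: "x \<in> P1Berk av" and i: "i \<le> d"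
  shows "form_val d x (monom 1 i - smult (form_eval d (monom 1 i) P) (unit_form d P)) \<le> lin_val av x P"
    (is "form_val d x ?p \<le> _")
proof (cases P)
  case None
  have p: "?p = (if i = d then 0 else monom 1 i)" using None by (simp add: form_eval_def unit_form_def)
  show ?thesis
  proof (cases "i = d")
    case True
    then show ?thesis unfolding p using lin_val_nonneg[OF x, of P] by (simp add: form_val_zero[OF x])
  next
    case False
    then have id: "i \<le> d - 1" "d \<ge> 1" using i by auto
    from x show ?thesis
    proof (cases rule: P1Berk_cases)
      case Inf
      then show ?thesis unfolding p using False None by simp
    next
      case (Aff s)
      interpret berk_point av s by fact
      define M where "M = max 1 (s [:0, 1:])"
      have M: "M \<ge> 1" "s [:0, 1:] \<le> M" by (auto simp: M_def)
      have "s [:0, 1:] ^ i \<le> M ^ i" using M by (intro power_mono) auto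
      also have "\<dots> \<le> M ^ (d - 1)" using M id by (intro power_increasing)
      finally have "s [:0, 1:] ^ i / M ^ d \<le> M ^ (d - 1) / M ^ d"
        using M by (intro divide_right_mono) auto
      also have "\<dots> = 1 / M" using M id by (cases d) auto
      finally show ?thesis unfolding p using False None Aff by (simp add: monom M_def)
    qed
  qed
next
  case (Some a)
  show ?thesis
  proof (cases "av a \<le> 1")
    case True
    have p: "?p = monom 1 i - [:a ^ i:]"
      using True Some by (simp add: form_eval_def unit_form_def poly_monom)
    show ?thesis
    proof (cases "i = 0")
      case True
      then have "?p = 0" unfolding p by (simp add: monom_0)
      then show ?thesis using lin_val_nonneg[OF x, of P] by (simp add: form_val_zero[OF x])
    next
      case i0: False
      from x show ?thesis
      proof (cases rule: P1Berk_cases)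
        case Inf
        have "coeff [:a ^ i:] d = 0" using i0 i by (intro coeff_eq_0) simp
        then show ?thesis unfolding p using Inf True Some by simp
      next
        case (Aff s)
        interpret berk_point av s by fact
        define M where "M = max 1 (s [:0, 1:])"
        have M: "M \<ge> 1" "max (s [:0, 1:]) (av a) \<le> M" using True by (auto simp: M_def)
        have "s ?p \<le> s [:-a, 1:] * max (s [:0, 1:]) (av a) ^ (i - 1)"
          unfolding p by (rule X_power_diff_le) (use i0 in simp)
        also have "\<dots> \<le> s [:-a, 1:] * M ^ (i - 1)"
          using M by (intro mult_left_mono power_mono) (auto simp: le_max_iff_disj)
        also have "\<dots> \<le> s [:-a, 1:] * M ^ (d - 1)"
          using M i by (intro mult_left_mono power_increasing) auto
        finally have "s ?p / M ^ d \<le> s [:-a, 1:] * M ^ (d - 1) / M ^ d"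
          using M by (intro divide_right_mono) auto
        also have "\<dots> = s [:-a, 1:] / M" using M i i0 by (cases d) auto
        finally show ?thesis unfolding p using Aff Some True by (simp flip: M_def)
      qed
    qed
  next
    case False
    then have a: "a \<noteq> 0" "av a > 1" by auto
    show ?thesis
    proof (cases "i = d")
      case True
      then have "?p = 0" using False Some a by (simp add: form_eval_def unit_form_def poly_monom smult_monom)
      then show ?thesis using lin_val_nonneg[OF x, of P] by (simp add: form_val_zero[OF x])
    next
      case id: False
      \<comment> \<open>The difference is -T^i (T^e - a^e) / a^e. Division by a^e leaves exactly the
        factor 1/|a| of the normalised linear form.\<close>
      define e where "e = d - i"
      have e: "e \<ge> 1" "d = i + e" using id i by (auto simp: e_def)
      have p: "?p = monom 1 i - monom (1 / a ^ e) d"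
        using False Some a e by (simp add: form_eval_def unit_form_def poly_monom smult_monom power_add)
      from x show ?thesis
      proof (cases rule: P1Berk_cases)
        case Inf
        have "av a * 1 \<le> av a * av a ^ (e - 1)" using a by (intro mult_left_mono one_le_power) auto
        then have "av a \<le> av a ^ e" using e by (cases e) auto
        then show ?thesis unfolding p using Inf id Some a by (simp add: field_simps)
      next
        case (Aff s)
        interpret berk_point av s by fact
        define M where "M = max 1 (s [:0, 1:])"
        have M: "M \<ge> 1" "s [:0, 1:] \<le> M" by (auto simp: M_def)
        let ?m = "max (s [:0, 1:]) (av a)"
        have "s [:0, 1:] * 1 \<le> M * av a" "1 * av a \<le> M * av a"
          using M a by (intro mult_mono; simp)+
        then have m: "?m \<le> M * av a" by simp
        have "?p = - smult (1 / a ^ e) (monom 1 i * (monom 1 e - [:a ^ e:]))"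
          unfolding p using a by (simp add: e(2) right_diff_distrib mult_monom smult_diff_right smult_monom)
        then have "s ?p = s [:0, 1:] ^ i * s (monom 1 e - [:a ^ e:]) / av a ^ e"
          by (simp add: mult monom)
        also have "\<dots> \<le> M ^ i * (s [:-a, 1:] * (M * av a) ^ (e - 1)) / av a ^ e"
        proof (intro divide_right_mono mult_mono power_mono)
          show "s (monom 1 e - [:a ^ e:]) \<le> s [:-a, 1:] * (M * av a) ^ (e - 1)"
            using m by (intro order_trans[OF X_power_diff_le[OF e(1)]] mult_left_mono power_mono)
              (auto simp: le_max_iff_disj)
        qed (use M in auto)
        also have "\<dots> = s [:-a, 1:] * M ^ (d - 1) / av a"
        proof -
          obtain e' where e': "e = Suc e'" using e by (cases e) auto
          show ?thesis using a unfolding e(2) e' by (simp add: power_mult_distrib power_add)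
        qed
        finally have "s ?p / M ^ d \<le> s [:-a, 1:] * M ^ (d - 1) / av a / M ^ d"
          using M by (intro divide_right_mono) auto
        also have "M ^ d = M * M ^ (d - 1)" using \<open>i \<le> d\<close> id by (cases d) auto
        then have "s [:-a, 1:] * M ^ (d - 1) / av a / M ^ d = s [:-a, 1:] / (M * av a)" using M by simp
        finally show ?thesis unfolding p using Aff Some a by (simp flip: M_def)
      qed
    qed
  qed
qed

text \<open>Everything is linear in \<open>p\<close>, so integral coefficients and the ultrametric
  inequality reduce the bound to monomials. It is a first-order estimate: an integral form moves by
  at most the distance to P.\<close>

lemma form_val_diff_form_eval:
  assumes x: "x \<in> P1Berk av" and p: "degree p \<le> d" "\<And>i. av (coeff p i) \<le> 1"
  shows "form_val d x (p - smult (form_eval d p P) (unit_form d P)) \<le> lin_val av x P"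
proof -
  have sum: "p = (\<Sum>i\<le>d. smult (coeff p i) (monom 1 i))"
    using poly_as_sum_of_monoms'[OF p(1)] by (simp add: smult_monom)
  have "form_eval d p P = (\<Sum>i\<le>d. coeff p i * form_eval d (monom 1 i) P)"
  proof (cases P)
    case None
    then show ?thesis by (simp add: form_eval_def if_distrib cong: if_cong)
  next
    case (Some a)
    then have "form_eval d p P = poly (\<Sum>i\<le>d. smult (coeff p i) (monom 1 i)) a"
      by (simp add: form_eval_def flip: sum)
    then show ?thesis using Some by (simp add: form_eval_def poly_sum)
  qed
  then have "p - smult (form_eval d p P) (unit_form d P) =
    (\<Sum>i\<le>d. smult (coeff p i) (monom 1 i - smult (form_eval d (monom 1 i) P) (unit_form d P)))"
    by (subst sum) (simp add: smult_sum smult_diff_right sum_subtractf)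
  moreover have "form_val d x (smult (coeff p i) (monom 1 i - smult (form_eval d (monom 1 i) P) (unit_form d P)))
      \<le> lin_val av x P" if "i \<in> {..d}" for i
    using mult_mono[OF p(2)[of i] form_val_monom_diff[OF x, of i d P]] that
    by (simp add: form_val_smult[OF x] form_val_nonneg[OF x])
  ultimately show ?thesis
    by (simp only: form_val_sum_le[OF x] lin_val_nonneg[OF x])
qed

end

subsection \<open>Action on the Berkovich line\<close>

locale rational_map = nonarch_closed av for av :: "'k::field \<Rightarrow> real" +
  fixes d :: nat and f g :: "'k poly"
  assumes d: "d \<ge> 1" and rep: "normalized_rep av d f g"
begin

lemma degrees: "degree f \<le> d" "degree g \<le> d" using rep by (auto simp: normalized_rep_def)

lemma integral: "av (coeff f i) \<le> 1" "av (coeff g i) \<le> 1"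
  using rep by (auto simp: normalized_rep_def)

abbreviation phi :: "'k berk \<Rightarrow> 'k berk" where "phi \<equiv> phi_berk av d f g"

abbreviation R :: real where "R \<equiv> av (Res_hom d f g)"

text \<open>The norm of the image coordinates (F, G); dividing by it brings them to norm
  one.\<close>

definition phi_norm :: "'k berk \<Rightarrow> real" where
  "phi_norm x = max (form_val d x f) (form_val d x g)"

lemma R_pos: "R > 0"
  using Res_hom_nonzero[OF d degrees] rep by (auto simp: normalized_rep_def)

lemma adj_integral:
  assumes "i < 2 * d" and "k < 2 * d"
  shows "av (adj_mat (sylvester_mat_sub d d f g) $$ (k, i)) \<le> 1"
proof -
  let ?S = "sylvester_mat_sub d d f g"
  have entries: "av (?S $$ (i, j)) \<le> 1" if "i < 2 * d" "j < 2 * d" for i j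
    using that by (subst sylvester_mat_sub_index) (auto simp: integral)
  have "av (det (mat_delete ?S i k)) \<le> 1"
  proof (rule av_det_le_1)
    show "mat_delete ?S i k \<in> carrier_mat (2 * d - 1) (2 * d - 1)"
      using mat_delete_carrier[OF sylvester_mat_sub_carrier[of d d f g]] by (simp add: mult_2)
  next
    fix i' j' assume "i' < 2 * d - 1" "j' < 2 * d - 1"
    then show "av (mat_delete ?S i k $$ (i', j')) \<le> 1"
      by (auto simp: mat_delete_def mult_2 intro!: entries)
  qed
  then show ?thesis using assms by (simp add: adj_mat_def cofactor_def mult_2)
qed

text \<open>At normalised coordinates X or Y has norm one, so at every point one of the identities
  for X^(2d-1) (\<open>k = 0\<close>) and Y^(2d-1) (\<open>k = 2 * d - 1\<close>) has left side of
  value |Res|. Its multipliers of F and G are integral.\<close>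

lemma R_le_phi_norm:
  assumes x: "x \<in> P1Berk av"
  shows "R \<le> phi_norm x"
proof -
  have nonneg: "phi_norm x \<ge> 0" by (simp add: phi_norm_def form_val_nonneg[OF x] le_max_iff_disj)
  have dd: "2 * d - 1 = d + (d - 1)" using d by simp
  have row: "form_val (2 * d - 1) x (sylv_row d f g i) \<le> phi_norm x" if "i < 2 * d" for i
  proof (cases "i < d")
    case True
    then show ?thesis
      using form_val_monom_mult[OF x degrees(1), of "d - 1 - i" "d - 1"]
      unfolding dd by (simp add: sylv_row_def phi_norm_def le_max_iff_disj)
  next
    case False
    then have "form_val (d + (d - 1)) x (monom 1 (2 * d - 1 - i) * g) \<le> form_val d x g"
      by (intro form_val_monom_mult[OF x degrees(2)]) simp
    then have "form_val (2 * d - 1) x (monom 1 (2 * d - 1 - i) * g) \<le> form_val d x g"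
      by (simp only: dd[symmetric])
    then show ?thesis using False by (simp add: sylv_row_def phi_norm_def le_max_iff_disj)
  qed
  have main: "form_val (2 * d - 1) x (monom (Res_hom d f g) (2 * d - 1 - k)) \<le> phi_norm x" if k: "k < 2 * d" for k
    unfolding Res_hom_bezout[OF d degrees k, symmetric]
  proof (rule form_val_sum_le[OF x])
    fix i assume "i \<in> {..<2 * d}"
    then have i: "i < 2 * d" by simp
    show "form_val (2 * d - 1) x (smult (adj_mat (sylvester_mat_sub d d f g) $$ (k, i)) (sylv_row d f g i))
      \<le> phi_norm x"
      using mult_mono[OF adj_integral[OF i k] row[OF i]] form_val_nonneg[OF x]
      by (simp add: form_val_smult[OF x])
  qed (rule nonneg)
  from x show ?thesis
  proof (cases rule: P1Berk_cases)
    case Inf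
    then show ?thesis using main[of 0] d by simp
  next
    case (Aff s)
    interpret berk_point av s by fact
    show ?thesis
    proof (cases "s [:0, 1:] \<le> 1")
      case True
      then show ?thesis using main[of "2 * d - 1"] d Aff by (simp add: monom max_absorb1)
    next
      case False
      then show ?thesis using main[of 0] d Aff by (simp add: monom max_absorb2)
    qed
  qed
qed

lemma phi_norm_pos: "x \<in> P1Berk av \<Longrightarrow> phi_norm x > 0"
  using R_le_phi_norm[of x] R_pos by linarith

section \<open>Pullback of linear forms and contraction of joins\<close>

lemma phi_P1Berk:
  assumes "x \<in> P1Berk av"
  shows "phi x \<in> P1Berk av"
  using assms
proof (cases rule: P1Berk_cases)
  case Inf
  then show ?thesis by (simp add: phi_berk_def BInf_P1Berk BAff_P1Berk type1_def type1_seminorm)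
next
  case (Aff s)
  then show ?thesis
    by (simp add: phi_berk_def BInf_P1Berk BAff_P1Berk hcomp_seminorm berk_point.seminorm)
qed

lemma phi_berk_of: "phi (berk_of av P) = berk_of av (phi_P1 d f g P)"
  by (cases P) (auto simp: berk_of_def phi_berk_def phi_P1_def type1_def poly_hcomp)

lemma lin_val_phi_None:
  assumes x: "x \<in> P1Berk av"
  shows "lin_val av (phi x) None * phi_norm x = form_val d x g"
  using x
proof (cases rule: P1Berk_cases)
  case Inf
  show ?thesis
  proof (cases "coeff g d = 0")
    case False
    then have "av (coeff g d) > 0" by simp
    then show ?thesis using Inf False
      by (simp add: phi_berk_def type1_def phi_norm_def max_1_divide del: av_pos)
  qed (use Inf in \<open>simp add: phi_berk_def\<close>)
next
  case (Aff s)
  interpret berk_point av s by fact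
  show ?thesis
  proof (cases "s g = 0")
    case False
    then have g: "s g > 0" using nonneg[of g] by linarith
    define M where "M = max 1 (s [:0, 1:]) ^ d"
    have M: "M > 0" by (simp add: M_def)
    have "max (s f / M) (s g / M) = max (s f) (s g) / M"
      using M by (auto simp: max_def divide_right_mono field_simps)
    moreover have "max (s f) (s g) > 0" using g by (simp add: less_max_iff_disj)
    ultimately show ?thesis using Aff False g M hcomp_linear[of f g 0]
      by (simp add: phi_berk_def phi_norm_def max_1_divide flip: M_def)
  qed (use Aff in \<open>simp add: phi_berk_def\<close>)
qed

text \<open>The linear form X - bY pulls back to F - bG; \<open>phi_norm x\<close> accounts for the
  scaling of the image point and max(1,|b|) for that of the form.\<close>

lemma lin_val_phi_Some:
  assumes x: "x \<in> P1Berk av"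
  shows "lin_val av (phi x) (Some b) * (phi_norm x * max 1 (av b)) = form_val d x (f - smult b g)"
  using x
proof (cases rule: P1Berk_cases)
  case Inf
  show ?thesis
  proof (cases "coeff g d = 0")
    case True
    then show ?thesis using Inf by (simp add: phi_berk_def phi_norm_def max_absorb1)
  next
    case False
    then have g: "av (coeff g d) > 0" by simp
    have "max (av (coeff f d)) (av (coeff g d)) > 0" using g by (simp add: less_max_iff_disj)
    moreover have "av (coeff f d / coeff g d - b) * av (coeff g d) = av (coeff f d - b * coeff g d)"
      using False by (simp add: field_simps flip: av_mult)
    ultimately show ?thesis using Inf False g
      by (simp add: phi_berk_def type1_def phi_norm_def max_1_divide del: av_pos)
  qed
next
  case (Aff s)
  interpret berk_point av s by fact
  define M where "M = max 1 (s [:0, 1:]) ^ d"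
  have M: "M > 0" by (simp add: M_def)
  show ?thesis
  proof (cases "s g = 0")
    case True
    have "s (f - smult b g) = s f"
      using diff[of f "smult b g"] add[of "f - smult b g" "smult b g"] True by simp
    then show ?thesis using Aff True by (simp add: phi_berk_def phi_norm_def max_absorb1)
  next
    case False
    then have g: "s g > 0" using nonneg[of g] by linarith
    have "max (s f / M) (s g / M) = max (s f) (s g) / M"
      using M by (auto simp: max_def divide_right_mono field_simps)
    moreover have "max (s f) (s g) > 0" using g by (simp add: less_max_iff_disj)
    ultimately show ?thesis using Aff False g M hcomp_linear[of f g 0]
      by (simp add: phi_berk_def phi_norm_def max_1_divide hcomp_linear flip: M_def)
  qed
qed

text \<open>The scale \<open>c\<close> depends on Q but not on the point, so it cancels when two
  points are compared.\<close>

lemma lin_val_phi_form: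
  "\<exists>L c. degree L \<le> d \<and> c > 0 \<and>
    (\<forall>x\<in>P1Berk av. lin_val av (phi x) Q * (phi_norm x * c) = form_val d x L)"
proof (cases Q)
  case None
  then show ?thesis using lin_val_phi_None degrees by (intro exI[of _ g] exI[of _ 1]) simp
next
  case (Some b)
  have "degree (f - smult b g) \<le> d"
    using degrees by (intro degree_diff_le) (auto intro: order_trans[OF degree_smult_le])
  then show ?thesis using lin_val_phi_Some Some
    by (intro exI[of _ "f - smult b g"] exI[of _ "max 1 (av b)"]) simp
qed

lemma lin_val_phi_phi_P1:
  assumes x: "x \<in> P1Berk av"
  shows "lin_val av (phi x) (phi_P1 d f g P) * phi_norm x \<le> lin_val av x P"
proof -
  define A where "A = form_eval d f P"
  define B where "B = form_eval d g P"
  define m where "m = max (av A) (av B)"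
  have Q: "phi_P1 d f g P = (if B = 0 then None else Some (A / B))"
    by (simp add: phi_P1_def A_def B_def form_eval_def split: option.split)
  \<comment> \<open>Positivity at the type I point P says that F and G do not both vanish
    there.\<close>
  have "phi_norm (berk_of av P) > 0" by (rule phi_norm_pos[OF berk_of_P1Berk])
  then have "A \<noteq> 0 \<or> B \<noteq> 0"
    by (auto simp: phi_norm_def berk_of_def type1_def A_def B_def form_eval_def split: option.splits)
  then have m: "m > 0" by (auto simp: m_def less_max_iff_disj)
  have "lin_val av (phi x) (phi_P1 d f g P) * phi_norm x * m = form_val d x (smult B f - smult A g)"
  proof (cases "B = 0")
    case True
    then show ?thesis using lin_val_phi_None[OF x]
      by (simp add: Q m_def max_absorb1 form_val_minus[OF x] form_val_smult[OF x] mult_ac)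
  next
    case False
    have "form_val d x (smult B f - smult A g) = av B * form_val d x (f - smult (A / B) g)"
      using False by (simp add: smult_diff_right flip: form_val_smult[OF x])
    also have "\<dots> = av B * (lin_val av (phi x) (Some (A / B)) * (phi_norm x * max 1 (av (A / B))))"
      by (simp only: lin_val_phi_Some[OF x])
    also have "\<dots> = lin_val av (phi x) (Some (A / B)) * phi_norm x * (av B * max 1 (av (A / B)))"
      by (simp only: mult_ac)
    also have "av B * max 1 (av (A / B)) = m"
      using False max_1_divide[of "av B" "av A"] by (simp add: m_def)
    finally show ?thesis using False Q by simp
  qed
  \<comment> \<open>The two multiples of the unit form cancel. Each bracket vanishes at P and obeys
    the first-order estimate, with weight at most m.\<close>
  also have "smult B f - smult A g = smult B (f - smult A (unit_form d P)) - smult A (g - smult B (unit_form d P))"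
    by (simp add: smult_diff_right mult.commute)
  also have "form_val d x \<dots> \<le> m * lin_val av x P"
  proof -
    have "av B * form_val d x (f - smult A (unit_form d P)) \<le> m * lin_val av x P"
      "av A * form_val d x (g - smult B (unit_form d P)) \<le> m * lin_val av x P"
      unfolding A_def B_def using m
      by (auto intro!: mult_mono form_val_diff_form_eval x degrees integral form_val_nonneg
          simp: m_def A_def B_def)
    then show ?thesis
      using form_val_diff[OF x, of d "smult B (f - smult A (unit_form d P))" "smult A (g - smult B (unit_form d P))"]
      by (simp add: form_val_smult[OF x])
  qed
  finally show ?thesis using m by (simp add: mult.commute)
qed

lemma lin_val_phi_le:
  assumes x: "x \<in> P1Berk av"
  shows "lin_val av (phi x) (phi_P1 d f g P) * R \<le> lin_val av x P"
  using mult_left_mono[OF R_le_phi_norm[OF x] lin_val_nonneg[OF phi_P1Berk[OF x], of "phi_P1 d f g P"]]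
    lin_val_phi_phi_P1[OF x, of P] by linarith

lemma bjoin_phi_le:
  assumes x: "x \<in> P1Berk av" and y: "y \<in> P1Berk av"
  shows "bjoin (phi x) (phi y) * R \<le> bjoin x y"
proof (rule bjoin_greatest)
  fix P
  let ?Q = "phi_P1 d f g P"
  have "bjoin (phi x) (phi y) * R \<le> max (lin_val av (phi x) ?Q) (lin_val av (phi y) ?Q) * R"
    using bjoin_le[OF phi_P1Berk[OF x]] R_pos by (intro mult_right_mono) auto
  then show "bjoin (phi x) (phi y) * R \<le> max (lin_val av x P) (lin_val av y P)"
    using lin_val_phi_le[OF x, of P] lin_val_phi_le[OF y, of P] by (auto simp: max_def split: if_splits)
qed

theorem Lip_P1_le: "Lip_P1 av d f g \<le> ereal (1 / R)"
  unfolding Lip_P1_def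
proof (rule SUP_least, clarsimp)
  fix P Q :: "'k option" assume "P \<noteq> Q"
  then have "chordal av P Q > 0" by (rule chordal_pos)
  moreover have "chordal av (phi_P1 d f g P) (phi_P1 d f g Q) * R \<le> chordal av P Q"
    using lin_val_phi_le[OF berk_of_P1Berk, of P Q] by (simp add: chordal_eq phi_berk_of)
  ultimately show "chordal av (phi_P1 d f g P) (phi_P1 d f g Q) / chordal av P Q \<le> 1 / R"
    using R_pos by (simp add: field_simps)
qed

subsection \<open>Lipschitz estimates along paths\<close>

text \<open>For j between \<open>bdiam x\<close> and 1 this parametrises the path from
  \<open>x\<close> to the Gauss point by G-diameter; \<open>lin_val_inject\<close> makes the choice
  unique.\<close>

definition trunc :: "'k berk \<Rightarrow> real \<Rightarrow> 'k berk" where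
  "trunc x j = (SOME z. z \<in> P1Berk av \<and> (\<forall>P. lin_val av z P = max j (lin_val av x P)))"

lemma trunc:
  assumes "x \<in> P1Berk av" and "bdiam x \<le> j" and "j \<le> 1"
  shows "trunc x j \<in> P1Berk av" and "lin_val av (trunc x j) P = max j (lin_val av x P)"
proof -
  have "trunc x j \<in> P1Berk av \<and> (\<forall>P. lin_val av (trunc x j) P = max j (lin_val av x P))"
    unfolding trunc_def using truncation_exists[OF assms] unfolding Bex_def by (rule someI_ex)
  then show "trunc x j \<in> P1Berk av" "lin_val av (trunc x j) P = max j (lin_val av x P)" by auto
qed

lemma trunc_bdiam: "x \<in> P1Berk av \<Longrightarrow> trunc x (bdiam x) = x"
  using bdiam_le[of x] bdiam_le_1[of x]
  by (intro lin_val_inject) (auto simp: trunc max_absorb2)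

lemma bdiam_trunc: "x \<in> P1Berk av \<Longrightarrow> bdiam x \<le> j \<Longrightarrow> j \<le> 1 \<Longrightarrow> bdiam (trunc x j) = j"
  by (rule bdiam_truncation) (auto simp: trunc)

lemma bjoin_lin_le: "lin_le u v \<Longrightarrow> bjoin u v = bdiam v"
  unfolding bjoin_def bdiam_def lin_le_def by (simp add: max_absorb2)

lemma bdist_refl: "bdist x x = 0"
  by (simp add: bdist_def bjoin_lin_le lin_le_refl)

lemma bdist_nonneg: "x \<in> P1Berk av \<Longrightarrow> y \<in> P1Berk av \<Longrightarrow> bdist x y \<ge> 0"
  using bdiam_le_bjoin[of x y] bdiam_le_bjoin[of y x] by (simp add: bdist_def bjoin_commute)

end

context rational_map begin

text \<open>In terms of the hyperbolic path metric: \<open>phi\<close> stretches it by at most \<open>d\<close>. The path distance between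
  two points is the supremum over pairs of linear forms of the logarithm of a cross ratio, and in a cross
  ratio of the values of $F - bG$ the normalising factors of the image points cancel.\<close>

lemma bjoin_phi_power2_le:
  assumes u: "u \<in> P1Berk av" and v: "v \<in> P1Berk av" and uv: "lin_le u v"
    and le: "\<And>P. lin_val av v P \<le> k * lin_val av u P" and k: "k \<ge> 1"
  shows "(bjoin (phi u) (phi v))\<^sup>2 \<le> k ^ d * (bdiam (phi u) * bdiam (phi v))"
proof -
  define J where "J = bjoin (phi u) (phi v)"
  define l where "l = k ^ d"
  define a where "a = phi_norm u"
  define b where "b = phi_norm v"
  note pu = phi_P1Berk[OF u] and pv = phi_P1Berk[OF v]
  have l: "l \<ge> 1" using k by (simp add: l_def)
  have a: "a > 0" and b: "b > 0" using phi_norm_pos u v by (auto simp: a_def b_def)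
  have mono: "form_val d u p \<le> form_val d v p" "form_val d v p \<le> l * form_val d u p"
    if "degree p \<le> d" for p
    using form_val_mono[OF u v, of 1 p d] form_val_mono[OF v u, of k p d] uv le k that
    by (auto simp: lin_le_def l_def)
  have ab: "a \<le> b" using mono[OF degrees(1)] mono[OF degrees(2)] by (auto simp: a_def b_def phi_norm_def)
  have ba: "b \<le> l * a"
  proof -
    have "l * form_val d u f \<le> l * a" "l * form_val d u g \<le> l * a"
      using l by (auto intro!: mult_left_mono simp: a_def phi_norm_def)
    then show ?thesis using mono(2)[OF degrees(1)] mono(2)[OF degrees(2)]
      by (auto simp: b_def phi_norm_def)
  qed
  have N: "lin_val av (phi u) Q * a \<le> lin_val av (phi v) Q * b"
    "lin_val av (phi v) Q * b \<le> l * (lin_val av (phi u) Q * a)" for Q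
  proof -
    obtain L c where L: "degree L \<le> d" "c > 0"
      "\<And>x. x \<in> P1Berk av \<Longrightarrow> lin_val av (phi x) Q * (phi_norm x * c) = form_val d x L"
      using lin_val_phi_form[of Q] by blast
    have "(lin_val av (phi u) Q * a) * c \<le> (lin_val av (phi v) Q * b) * c"
      using mono(1)[OF L(1)] L(3)[OF u] L(3)[OF v] by (simp add: a_def b_def mult.assoc)
    then show "lin_val av (phi u) Q * a \<le> lin_val av (phi v) Q * b" using L(2) by simp
    have "(lin_val av (phi v) Q * b) * c \<le> (l * (lin_val av (phi u) Q * a)) * c"
      using mono(2)[OF L(1)] L(3)[OF u] L(3)[OF v] by (simp add: a_def b_def mult.assoc)
    then show "lin_val av (phi v) Q * b \<le> l * (lin_val av (phi u) Q * a)" using L(2) by simp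
  qed
  have J: "J \<ge> 0" "bdiam (phi u) \<le> J" "bdiam (phi v) \<le> J"
    using bdiam_le_bjoin[OF pu, of "phi v"] bdiam_le_bjoin[OF pv, of "phi u"] bdiam_nonneg[OF pu]
    by (auto simp: J_def bjoin_commute)
  \<comment> \<open>If J is one of the diameters, that image is the join itself, and
    \<open>N\<close> with the ratio of \<open>a\<close> and \<open>b\<close> bounds the other
    diameter. Otherwise the images lie in different branches below the join.\<close>
  consider "bdiam (phi u) = J" | "bdiam (phi v) = J" | "bdiam (phi u) < J" "bdiam (phi v) < J"
    using J by linarith
  then have "J * J \<le> l * (bdiam (phi u) * bdiam (phi v))"
  proof cases
    case 1
    have "J / l \<le> lin_val av (phi v) Q" for Q
    proof -
      have "J * a \<le> lin_val av (phi u) Q * a" using bdiam_le[OF pu, of Q] 1 a by (intro mult_right_mono) auto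
      also have "\<dots> \<le> lin_val av (phi v) Q * b" by (rule N)
      also have "\<dots> \<le> lin_val av (phi v) Q * (l * a)" using ba lin_val_nonneg[OF pv] by (intro mult_left_mono)
      finally have "J * a \<le> (lin_val av (phi v) Q * l) * a" by (simp add: mult.assoc)
      then show ?thesis using a l by (simp add: field_simps)
    qed
    then have "J / l \<le> bdiam (phi v)" by (rule bdiam_greatest)
    then have "J \<le> l * bdiam (phi v)" using l by (simp add: field_simps)
    then have "J * J \<le> J * (l * bdiam (phi v))" using J by (intro mult_left_mono)
    then show ?thesis by (simp add: 1 mult_ac)
  next
    case 2
    have "J / l \<le> lin_val av (phi u) Q" for Q
    proof -
      have "J * b \<le> lin_val av (phi v) Q * b" using bdiam_le[OF pv, of Q] 2 b by (intro mult_right_mono) auto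
      also have "\<dots> \<le> l * (lin_val av (phi u) Q * a)" by (rule N)
      also have "\<dots> \<le> l * (lin_val av (phi u) Q * b)"
        using ab l lin_val_nonneg[OF pu] by (intro mult_left_mono) auto
      finally have "J * b \<le> (lin_val av (phi u) Q * l) * b" by (simp add: mult_ac)
      then show ?thesis using b l by (simp add: field_simps)
    qed
    then have "J / l \<le> bdiam (phi u)" by (rule bdiam_greatest)
    then have "J \<le> l * bdiam (phi u)" using l by (simp add: field_simps)
    then have "J * J \<le> l * bdiam (phi u) * J" using J by (intro mult_right_mono)
    then show ?thesis by (simp add: 2 mult_ac)
  next
    case 3
    \<comment> \<open>A point Q with value below J at phi(v) has value at least J at phi(u), and
      \<open>N\<close> compares the two values. In the product with the mirrored bound below,
      \<open>a\<close> and \<open>b\<close> cancel and only \<open>l\<close> remains.\<close>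
    have "J * a / b \<le> bdiam (phi v)"
    proof (rule dense_ge_bounded[OF 3(2)])
      fix e assume e: "bdiam (phi v) < e" "e < J"
      obtain Q where Q: "lin_val av (phi v) Q < e" using bdiam_lessD[OF pv e(1)] by blast
      then have "J \<le> lin_val av (phi u) Q" using bjoin_le[OF pu, of "phi v" Q] e by (simp add: J_def)
      then have "J * a \<le> lin_val av (phi u) Q * a" using a by (intro mult_right_mono) auto
      also have "\<dots> \<le> lin_val av (phi v) Q * b" by (rule N)
      also have "\<dots> \<le> e * b" using Q b by (intro mult_right_mono) auto
      finally show "J * a / b \<le> e" using b by (simp add: field_simps)
    qed
    moreover have "J * b / (l * a) \<le> bdiam (phi u)"
    proof (rule dense_ge_bounded[OF 3(1)])
      fix e assume e: "bdiam (phi u) < e" "e < J"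
      obtain Q where Q: "lin_val av (phi u) Q < e" using bdiam_lessD[OF pu e(1)] by blast
      then have "J \<le> lin_val av (phi v) Q" using bjoin_le[OF pu, of "phi v" Q] e by (simp add: J_def)
      then have "J * b \<le> lin_val av (phi v) Q * b" using b by (intro mult_right_mono) auto
      also have "\<dots> \<le> l * (lin_val av (phi u) Q * a)" by (rule N)
      also have "\<dots> \<le> l * (e * a)" using Q a l by (intro mult_left_mono mult_right_mono) auto
      finally show "J * b / (l * a) \<le> e" using a l by (simp add: field_simps)
    qed
    ultimately have "(J * b / (l * a)) * (J * a / b) \<le> bdiam (phi u) * bdiam (phi v)"
      using J a b l bdiam_nonneg[OF pu] by (intro mult_mono) auto
    then show ?thesis using a b l by (simp add: field_simps)
  qed
  then show ?thesis by (simp add: J_def l_def power2_eq_square)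
qed

text \<open>The ratio of diameters is written k^2 so that the square root in AM-GM leaves k^d:
  2J/k^d <= \<delta> + \<epsilon>. Bernoulli's inequality then gives 1 - k^(-d) <= d (1 - 1/k), and
  J is at most the diameter of \<open>v\<close> over R.\<close>

lemma bdist_phi_short_segment:
  assumes u: "u \<in> P1Berk av" and v: "v \<in> P1Berk av" and uv: "lin_le u v"
    and le: "\<And>P. lin_val av v P \<le> k\<^sup>2 * lin_val av u P" and k: "k \<ge> 1"
    and i: "i > 0" and v_diam: "bdiam v = i * k\<^sup>2"
  shows "bdist (phi u) (phi v) \<le> k * (real d / R) * (i * k\<^sup>2 - i)"
proof -
  define J where "J = bjoin (phi u) (phi v)"
  define \<delta> where "\<delta> = bdiam (phi u)"
  define \<epsilon> where "\<epsilon> = bdiam (phi v)"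
  note pu = phi_P1Berk[OF u] and pv = phi_P1Berk[OF v]
  have pos: "\<delta> \<ge> 0" "\<epsilon> \<ge> 0" using bdiam_nonneg pu pv by (auto simp: \<delta>_def \<epsilon>_def)
  have J: "J \<ge> 0" using bdiam_le_bjoin[OF pu, of "phi v"] pos by (simp add: J_def \<delta>_def)
  have kd: "k ^ d \<ge> 1" using k by simp
  have "J\<^sup>2 \<le> (k\<^sup>2) ^ d * (\<delta> * \<epsilon>)"
    unfolding J_def \<delta>_def \<epsilon>_def using k by (intro bjoin_phi_power2_le[OF u v uv le]) auto
  then have "J\<^sup>2 \<le> (k ^ d)\<^sup>2 * (\<delta> * \<epsilon>)" by (simp add: power_mult[symmetric] mult.commute)
  moreover have "(k ^ d)\<^sup>2 > 0" using k by simp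
  ultimately have "J\<^sup>2 / (k ^ d)\<^sup>2 \<le> \<delta> * \<epsilon>" by (simp only: pos_divide_le_eq mult.commute)
  then have "(2 * J / k ^ d)\<^sup>2 \<le> 4 * (\<delta> * \<epsilon>)" by (simp add: power_divide)
  also have "\<dots> \<le> (\<delta> + \<epsilon>)\<^sup>2"
    using zero_le_power2[of "\<delta> - \<epsilon>"] by (simp add: power2_eq_square algebra_simps)
  finally have "2 * J / k ^ d \<le> \<delta> + \<epsilon>" by (rule power2_le_imp_le) (use pos in simp)
  then have "bdist (phi u) (phi v) \<le> 2 * J - 2 * J / k ^ d"
    by (simp add: bdist_def J_def \<delta>_def \<epsilon>_def)
  also have "\<dots> = 2 * J * (1 - (1 / k) ^ d)" by (simp add: power_one_over algebra_simps)
  also have "\<dots> \<le> 2 * J * (real d * (1 - 1 / k))"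
  proof (rule mult_left_mono)
    have "1 + real d * (1 / k - 1) \<le> (1 + (1 / k - 1)) ^ d"
      using k by (intro Bernoulli_inequality) auto
    then show "1 - (1 / k) ^ d \<le> real d * (1 - 1 / k)" by (simp add: algebra_simps)
  qed (use J in simp)
  also have "\<dots> \<le> 2 * (i * k\<^sup>2 / R) * (real d * (1 - 1 / k))"
  proof -
    have "J \<le> i * k\<^sup>2 / R"
      using bjoin_phi_le[OF u v] bjoin_lin_le[OF uv] R_pos v_diam by (simp add: J_def field_simps del: av_pos)
    then show ?thesis using k by (intro mult_right_mono) auto
  qed
  also have "\<dots> = (real d / R) * i * (k\<^sup>2 * (1 - 1 / k)) * 2" by simp
  also have "k\<^sup>2 * (1 - 1 / k) = k * (k - 1)" using k by (simp add: field_simps power2_eq_square)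
  \<comment> \<open>Rounding 2 up to k + 1 completes the difference of squares k^2 - 1 and leaves k
    as the only surplus factor.\<close>
  also have "(real d / R) * i * (k * (k - 1)) * 2 \<le> (real d / R) * i * (k * (k - 1)) * (k + 1)"
    using k i by (intro mult_left_mono) auto
  also have "\<dots> = (real d / R) * (i * (k * (k - 1)) * (k + 1))" by (simp only: mult.assoc)
  also have "i * (k * (k - 1)) * (k + 1) = k * (i * k\<^sup>2 - i)"
    by (simp add: power2_eq_square algebra_simps)
  also have "(real d / R) * (k * (i * k\<^sup>2 - i)) = k * (real d / R) * (i * k\<^sup>2 - i)"
    by (simp only: mult_ac)
  finally show ?thesis .
qed

context
  fixes x assumes x: "x \<in> P1Berk av"
begin

text \<open>Equal diameter ratios k^2 give every piece the same surplus factor k, so the bounds of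
  the pieces telescope.\<close>

lemma bdist_phi_geometric:
  assumes i: "i > 0" "bdiam x \<le> i" and k: "k \<ge> 1" and "i * k ^ (2 * n) \<le> 1"
  shows "bdist (phi (trunc x i)) (phi (trunc x (i * k ^ (2 * n)))) \<le> k * (real d / R) * (i * k ^ (2 * n) - i)"
  using assms(4)
proof (induction n)
  case 0
  then show ?case by (simp add: bdist_refl)
next
  case (Suc n)
  define j where "j = i * k ^ (2 * n)"
  have j': "i * k ^ (2 * Suc n) = j * k\<^sup>2" by (simp add: j_def power_add power2_eq_square)
  have k2: "1 \<le> k\<^sup>2" using k by simp
  have ij: "i \<le> j" using i k mult_left_mono[of 1 "k ^ (2 * n)" i] by (simp add: j_def)
  have jj: "j \<le> j * k\<^sup>2" using i ij k2 mult_left_mono[of 1 "k\<^sup>2" j] by simp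
  have j1: "j \<le> 1" "j * k\<^sup>2 \<le> 1" using Suc.prems jj unfolding j' by auto
  have b: "bdiam x \<le> j" "bdiam x \<le> j * k\<^sup>2" using i ij jj by linarith+
  note tj = trunc[OF x b(1) j1(1)] and tk = trunc[OF x b(2) j1(2)]
  have t: "trunc x i \<in> P1Berk av" "trunc x j \<in> P1Berk av" "trunc x (j * k\<^sup>2) \<in> P1Berk av"
    using i ij j1 tj tk by (auto intro!: trunc x)
  have "bdist (phi (trunc x j)) (phi (trunc x (j * k\<^sup>2))) \<le> k * (real d / R) * (j * k\<^sup>2 - j)"
  proof (rule bdist_phi_short_segment[OF t(2,3) _ _ k])
    show "lin_le (trunc x j) (trunc x (j * k\<^sup>2))"
      unfolding lin_le_def tj tk using jj by (blast intro: max.mono)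
    show "bdiam (trunc x (j * k\<^sup>2)) = j * k\<^sup>2" by (intro bdiam_trunc x b j1)
    fix P
    have "1 * lin_val av x P \<le> k\<^sup>2 * lin_val av x P"
      using k2 lin_val_nonneg[OF x] by (intro mult_right_mono) auto
    moreover have "k\<^sup>2 * lin_val av x P \<le> k\<^sup>2 * max j (lin_val av x P)" "k\<^sup>2 * j \<le> k\<^sup>2 * max j (lin_val av x P)"
      by (intro mult_left_mono; simp)+
    ultimately have "max (j * k\<^sup>2) (lin_val av x P) \<le> k\<^sup>2 * max j (lin_val av x P)"
      by (simp add: mult.commute)
    then show "lin_val av (trunc x (j * k\<^sup>2)) P \<le> k\<^sup>2 * lin_val av (trunc x j) P"
      unfolding tj tk .
  qed (use i ij in auto)
  moreover have "bdist (phi (trunc x i)) (phi (trunc x j)) \<le> k * (real d / R) * (j - i)"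
    using Suc.IH j1 by (simp add: j_def)
  moreover have "bdist (phi (trunc x i)) (phi (trunc x (j * k\<^sup>2)))
    \<le> bdist (phi (trunc x i)) (phi (trunc x j)) + bdist (phi (trunc x j)) (phi (trunc x (j * k\<^sup>2)))"
    using t by (intro bdist_triangle phi_P1Berk)
  moreover have "k * (real d / R) * (j * k\<^sup>2 - i) = k * (real d / R) * (j - i) + k * (real d / R) * (j * k\<^sup>2 - j)"
    by (subst distrib_left[symmetric]) simp
  ultimately show ?case unfolding j' by linarith
qed

lemma bdist_phi_segment:
  assumes i: "i > 0" "bdiam x \<le> i" and j: "i \<le> j" "j \<le> 1"
  shows "bdist (phi (trunc x i)) (phi (trunc x j)) \<le> real d / R * (j - i)"
proof -
  \<comment> \<open>The ratio for which n + 1 pieces lead from diameter i to j; it tends to 1, and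
    the surplus factor with it.\<close>
  define k where "k n = root (2 * Suc n) (j / i)" for n
  have k1: "k n \<ge> 1" for n using i j by (simp add: k_def)
  have kn: "i * k n ^ (2 * Suc n) = j" for n
    using i j unfolding k_def by (subst real_root_pow_pos2) auto
  have "(\<lambda>n. root n (j / i)) \<longlonglongrightarrow> 1" using i j by (intro LIMSEQ_root_const) auto
  moreover have "strict_mono (\<lambda>n. 2 * Suc n)" by (auto intro: strict_monoI)
  ultimately have "((\<lambda>n. root n (j / i)) \<circ> (\<lambda>n. 2 * Suc n)) \<longlonglongrightarrow> 1" by (rule LIMSEQ_subseq_LIMSEQ)
  then have "k \<longlonglongrightarrow> 1" by (simp add: k_def[abs_def] o_def)
  then have "(\<lambda>n. k n * (real d / R) * (j - i)) \<longlonglongrightarrow> 1 * (real d / R) * (j - i)"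
    by (intro tendsto_intros)
  moreover have "bdist (phi (trunc x i)) (phi (trunc x j)) \<le> k n * (real d / R) * (j - i)" for n
    using bdist_phi_geometric[OF i k1, of n "Suc n"] j unfolding kn by simp
  ultimately show ?thesis by (intro LIMSEQ_le_const) auto
qed

text \<open>From diameter zero no finite geometric subdivision starts. The initial piece up to
  diameter e is bounded by twice the join of its image endpoints, hence by 2e/R, and e is
  arbitrarily small.\<close>

lemma bdist_phi_trunc:
  assumes j: "bdiam x \<le> j" "j \<le> 1"
  shows "bdist (phi x) (phi (trunc x j)) \<le> real d / R * (j - bdiam x)"
proof (cases "bdiam x > 0")
  case True
  then show ?thesis using bdist_phi_segment[of "bdiam x" j] j by (simp add: trunc_bdiam[OF x])
next
  case False
  then have x0: "bdiam x = 0" using bdiam_nonneg[OF x] by simp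
  show ?thesis
  proof (cases "j = 0")
    case True
    then show ?thesis using trunc_bdiam[OF x] x0 by (simp add: bdist_refl)
  next
    case False
    then have j0: "j > 0" using j x0 by simp
    have "bdist (phi x) (phi (trunc x j)) - real d / R * j \<le> 0"
    proof (rule dense_ge_bounded[of 0 "2 * j / R"])
      show "0 < 2 * j / R" using j0 R_pos by simp
    next
      fix c assume c: "0 < c" "c < 2 * j / R"
      \<comment> \<open>Chosen so that 2e/R = c; the upper limit imposed on c means e < j.\<close>
      define e where "e = c * R / 2"
      have e: "0 < e" "e < j" "c = 2 * e / R" using c R_pos by (auto simp: e_def field_simps)
      have t: "trunc x e \<in> P1Berk av" "trunc x j \<in> P1Berk av" using e j x0 by (auto intro!: trunc x)
      have "lin_le x (trunc x e)" using e j x0 by (simp add: lin_le_def trunc[OF x])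
      then have "bjoin x (trunc x e) = e" using e j x0 by (simp add: bjoin_lin_le bdiam_trunc[OF x])
      then have "bjoin (phi x) (phi (trunc x e)) * R \<le> e" using bjoin_phi_le[OF x t(1)] by simp
      then have "2 * bjoin (phi x) (phi (trunc x e)) \<le> c" using R_pos by (simp add: e(3) field_simps del: av_pos)
      then have "bdist (phi x) (phi (trunc x e)) \<le> c"
        using bdiam_nonneg[OF phi_P1Berk[OF x]] bdiam_nonneg[OF phi_P1Berk[OF t(1)]]
        by (simp add: bdist_def)
      moreover have "bdist (phi (trunc x e)) (phi (trunc x j)) \<le> real d / R * (j - e)"
        using bdist_phi_segment[of e j] e j x0 by simp
      moreover have "real d / R * (j - e) \<le> real d / R * j" using e by (intro mult_left_mono) auto
      ultimately show "bdist (phi x) (phi (trunc x j)) - real d / R * j \<le> c"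
        using bdist_triangle[OF phi_P1Berk[OF x] phi_P1Berk[OF t(2)] phi_P1Berk[OF t(1)]] by linarith
    qed
    then show ?thesis by (simp add: x0)
  qed
qed

end

text \<open>Both paths to the Gauss point pass through the join, where the truncations coincide, and
  \<open>bdist x y\<close> is the sum of the two diameter differences up to it.\<close>

lemma bdist_phi_le:
  assumes x: "x \<in> P1Berk av" and y: "y \<in> P1Berk av"
  shows "bdist (phi x) (phi y) \<le> real d / R * bdist x y"
proof -
  define j where "j = bjoin x y"
  have j: "bdiam x \<le> j" "bdiam y \<le> j" "j \<le> 1"
    using bdiam_le_bjoin[OF x, of y] bdiam_le_bjoin[OF y, of x] bjoin_le_1[OF x y]
    by (auto simp: j_def bjoin_commute)
  note tx = trunc[OF x j(1,3)] and ty = trunc[OF y j(2,3)]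
  have "trunc x j = trunc y j"
    using bjoin_truncation[OF x y, of "trunc x j"] tx ty
    by (intro lin_val_inject) (auto simp: j_def)
  then have "bdist (phi x) (phi y) \<le> bdist (phi x) (phi (trunc x j)) + bdist (phi y) (phi (trunc y j))"
    using bdist_triangle[OF phi_P1Berk[OF x] phi_P1Berk[OF y] phi_P1Berk[OF tx(1)]]
    by (simp add: bdist_commute)
  also have "\<dots> \<le> real d / R * (j - bdiam x) + real d / R * (j - bdiam y)"
    using j by (intro add_mono bdist_phi_trunc x y)
  also have "\<dots> = real d / R * ((j - bdiam x) + (j - bdiam y))" by (simp only: distrib_left)
  also have "(j - bdiam x) + (j - bdiam y) = bdist x y" by (simp add: bdist_def j_def)
  finally show ?thesis .
qed

theorem Lip_Berk_le: "Lip_Berk av d f g \<le> ereal (real d / R)"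
  unfolding Lip_Berk_def
proof (rule SUP_least, clarsimp)
  fix x y assume x: "x \<in> P1Berk av" and y: "y \<in> P1Berk av"
  have "bdist (phi x) (phi y) / bdist x y \<le> real d / R"
  \<comment> \<open>A quotient with denominator 0 is 0, which lies below the nonnegative
    bound.\<close>
  proof (cases "bdist x y = 0")
    case False
    then show ?thesis using bdist_phi_le[OF x y] bdist_nonneg[OF x y] by (simp add: divide_le_eq)
  qed simp
  then show "frl_dist av (phi x) (phi y) / frl_dist av x y \<le> real d / R"
    by (simp add: frl_dist_eq_bdist x y phi_P1Berk)
qed

end

theorem theorem1:
  fixes av :: "'k::field \<Rightarrow> real" and d :: nat and f g :: "'k poly"
  assumes "nonarch_abs av" and "nontrivial_abs av" and "complete_abs av"
    and "alg_closed TYPE('k)"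
    and "d \<ge> 1" and "normalized_rep av d f g"
  shows "Lip_P1 av d f g \<le> ereal (1 / av (Res_hom d f g))
    \<and> Lip_Berk av d f g \<le> ereal (max (real d / av (Res_hom d f g)) (1 / av (Res_hom d f g) ^ d))"
proof -
  interpret rational_map av d f g
    by unfold_locales (use assms in auto)
  have "ereal (real d / R) \<le> ereal (max (real d / R) (1 / R ^ d))" by simp
  then show ?thesis using Lip_P1_le order_trans[OF Lip_Berk_le] by blast
qed

end
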